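(* Let $1\le k<n$, let $S$ be an iterated sequence for $\mathrm{Gr}(k,\mathbb C^n)$, and let $M_S$ be the weighting matrix of the associated valuation $\mathfrak v_S$. Then there exists a cone $C\subset\mathrm{trop}(\mathrm{Gr}(k,\mathbb C^n))$ such that $$\mathrm{in}_{M_S}(\mathcal I_{k,n})=\mathrm{in}_C(\mathcal I_{k,n}).$$
   Context: Roots and birational sequences. Positive roots of type $\mathtt A_{n-1}$ are $\varepsilon_i-\varepsilon_j$, $1\le i<j\le n$ ($\varepsilon_i$ the standard basis of $\mathbb R^n$). For $\beta=\varepsilon_i-\varepsilon_j$ let $f_\beta$ be the elementary $n\times n$ matrix with a $1$ in position $(j,i)$ and zeros elsewhere. Put $d=k(n-k)$. For a sequence $S=(\beta_1,\dots,\beta_d)$ of positive roots (repetitions allowed) let $\psi_S(y_1,\dots,y_d)=(\mathbb 1+y_1f_{\beta_1})\cdots(\mathbb 1+y_df_{\beta_d})$. $S$ is birational for $\mathrm{Gr}(k,\mathbb C^n)$ if the map $\mathbb A^d\to\mathrm{Gr}(k,\mathbb C^n)$ sending $y$ to the span of the first $k$ columns of $\psi_S(y)$ is birational. Iterated sequences. If $(\beta_1,\dots,\beta_d)$ is birational for $\mathrm{Gr}(k,\mathbb C^m)$ and $i_1,\dots,i_k\in\{1,\dots,m\}$ are pairwise distinct, then $(\varepsilon_{i_1}-\varepsilon_{m+1},\dots,\varepsilon_{i_k}-\varepsilon_{m+1},\beta_1,\dots,\beta_d)$ is birational for $\mathrm{Gr}(k,\mathbb C^{m+1})$. A birational sequence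 for $\mathrm{Gr}(k,\mathbb C^n)$ is iterated if it is obtained from some birational sequence for $\mathrm{Gr}(k,\mathbb C^{k+1})$ by applying such extensions $n-k-1$ times. Plücker ideal. $I_{k,n}$ is the set of sequences $\underline j=(j_1<\dots<j_k)$ in $\{1,\dots,n\}$. $\mathcal I_{k,n}\subset\mathbb C[p_{\underline j}\mid\underline j\in I_{k,n}]$ is the homogeneous ideal of $\mathrm{Gr}(k,\mathbb C^n)$ in its Plücker embedding, $A_{k,n}=\mathbb C[p_{\underline j}]/\mathcal I_{k,n}$, and $\bar p_{\underline j}$ is the class of $p_{\underline j}$. Valuation and weighting matrix. Let $\mathrm{ht}(\varepsilon_i-\varepsilon_j)=j-i$ and $\Psi(m)=\sum_{i=1}^d m_i\,\mathrm{ht}(\beta_i)$ for $m\in\mathbb Z^d$. Define the total order $\prec_\Psi$ on $\mathbb Z^d$ by $m\prec_\Psi n$ iff $\Psi(m)<\Psi(n)$, or $\Psi(m)=\Psi(n)$ and $m>_{\mathrm{lex}}n$. For $0\ne f=\sum a_uy^u\in\mathbb C[y_1,\dots,y_d]$ let $\mathfrak v_S(f)=\min_{\prec_\Psi}\{u\mid a_u\ne0\}$. Let $\psi_S^*(\bar p_{\underline j})\in\mathbb C[y_1,\dots,y_d]$ be the $k\times k$ minor of $\psi_S(y)$ on rows $\underline j$ and columns $1,\dots,k$, and put $\mathfrak v_S(\bar p_{\underline j})=\mathfrak v_S(\psi_S^*(\bar p_{\underline j}))$. $M_S\in\mathbb Z^{d\times\binom nk}$ is the matrix with columns $\mathfrak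 v_S(\bar p_{\underline j})$, $\underline j\in I_{k,n}$. Initial ideals. For $f=\sum a_up^u$ and $w\in\mathbb R^{\binom nk}$, $\mathrm{in}_w(f)$ is the sum of the terms $a_up^u$ ($a_u\neq 0$) with $w\cdot u$ minimal; $\mathrm{in}_{M_S}(f)$ is the sum of the terms $a_up^u$ ($a_u\ne0$) with $M_Su\in\mathbb Z^d$ minimal with respect to $\prec_\Psi$. For an ideal $I$, $\mathrm{in}_w(I)$ and $\mathrm{in}_{M_S}(I)$ are the ideals generated by the initial forms of all elements of $I$. Tropical Grassmannian. $\mathrm{trop}(\mathrm{Gr}(k,\mathbb C^n))=\{w\in\mathbb R^{\binom nk}\mid \mathrm{in}_w(\mathcal I_{k,n})\text{ contains no monomial}\}$, with the fan structure as a subfan of the Gröbner fan: $v,w$ lie in the relative interior of the same cone iff $\mathrm{in}_v(\mathcal I_{k,n})=\mathrm{in}_w(\mathcal I_{k,n})$. For a cone $C$, $\mathrm{in}_C(\mathcal I_{k,n}):=\mathrm{in}_w(\mathcal I_{k,n})$ for any $w$ in the relative interior of $C$. *)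

theory Defs
  imports
    "HOL-Library.Poly_Mapping"
    "HOL-Analysis.Finite_Function_Topology"
    "HOL-Analysis.Convex_Euclidean_Space"
    "HOL-Algebra.Ideal"
    "Jordan_Normal_Form.DL_Rank"
    "Jordan_Normal_Form.DL_Submatrix"
begin

text \<open>Rows, columns, coordinates of sequences and the indices of the roots
  are counted from \<open>0\<close>: the root \<open>\<epsilon>_{i+1} - \<epsilon>_{j+1}\<close> is the pair \<open>(i, j)\<close>, and
  \<open>\<beta>_{a+1}\<close> is \<open>S ! a\<close>. An increasing sequence of \<open>k\<close> elements of \<open>{1,\<dots>,n}\<close> is the
  \<open>k\<close>-element subset of \<open>{..<n}\<close> of its (shifted) members.\<close>

subsection \<open>Multivariate polynomials\<close>

text \<open>A polynomial in variables indexed by \<open>'x\<close> is a finitely supported function on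
  exponents, which are themselves finitely supported; the ring structure is the one of
  \<^theory>\<open>HOL-Library.Poly_Mapping\<close>.\<close>

type_synonym 'x mpoly = "('x \<Rightarrow>\<^sub>0 nat) \<Rightarrow>\<^sub>0 complex"

definition mvar :: "'x \<Rightarrow> 'x mpoly" where
  "mvar x = Poly_Mapping.single (Poly_Mapping.single x 1) 1"

definition mpoly_eval :: "'x mpoly \<Rightarrow> ('x \<Rightarrow> complex) \<Rightarrow> complex" where
  "mpoly_eval f a =
    (\<Sum>u\<in>Poly_Mapping.keys f. Poly_Mapping.lookup f u *
      (\<Prod>x\<in>Poly_Mapping.keys u. a x ^ Poly_Mapping.lookup u x))"

definition homogeneous_of_degree :: "nat \<Rightarrow> 'x mpoly \<Rightarrow> bool" where
  "homogeneous_of_degree e f \<longleftrightarrow>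
    (\<forall>u\<in>Poly_Mapping.keys f. (\<Sum>x\<in>Poly_Mapping.keys u. Poly_Mapping.lookup u x) = e)"

text \<open>The sum of the terms of \<open>f\<close> whose exponent is minimal for the strict order \<open>lt\<close>.\<close>

definition initial_form :: "(('x \<Rightarrow>\<^sub>0 nat) \<Rightarrow> ('x \<Rightarrow>\<^sub>0 nat) \<Rightarrow> bool) \<Rightarrow> 'x mpoly \<Rightarrow> 'x mpoly" where
  "initial_form lt f =
    (\<Sum>u\<in>{u \<in> Poly_Mapping.keys f. \<forall>v\<in>Poly_Mapping.keys f. \<not> lt v u}.
      Poly_Mapping.single u (Poly_Mapping.lookup f u))"

subsection \<open>The Grassmannian and its Pluecker ideal\<close>

definition plucker_index :: "nat \<Rightarrow> nat \<Rightarrow> nat set set" where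
  "plucker_index k n = {J. J \<subseteq> {..<n} \<and> card J = k}"

definition minor :: "nat \<Rightarrow> 'a::comm_ring_1 mat \<Rightarrow> nat set \<Rightarrow> 'a" where
  "minor k A J = Determinant.det (submatrix A J {..<k})"

definition grassmannian :: "nat \<Rightarrow> nat \<Rightarrow> complex vec set set" where
  "grassmannian k n = {W. VectorSpace.subspace class_ring W (module_vec TYPE(complex) n) \<and>
    vectorspace.dim class_ring (module_vec TYPE(complex) n\<lparr>carrier := W\<rparr>) = k}"

text \<open>Homogeneous coordinates of the image of \<open>W\<close> under the Pluecker embedding: the
  maximal minors of some matrix whose \<open>k\<close> columns span the \<open>k\<close>-dimensional space \<open>W\<close>.
  Another choice of matrix multiplies all of them by one nonzero scalar. Below they only
  occur in homogeneous equations and in quotients of homogeneous polynomials of equal degree.\<close>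

definition plucker_coords :: "nat \<Rightarrow> nat \<Rightarrow> complex vec set \<Rightarrow> nat set \<Rightarrow> complex" where
  "plucker_coords k n W =
    minor k (SOME A. A \<in> carrier_mat n k \<and> vec_space.col_space n A = W)"

definition plucker_ring :: "nat \<Rightarrow> nat \<Rightarrow> nat set mpoly ring" where
  "plucker_ring k n =
    \<lparr>carrier = {f. \<forall>u\<in>Poly_Mapping.keys f. Poly_Mapping.keys u \<subseteq> plucker_index k n},
     monoid.mult = (*), one = 1, zero = 0, add = (+)\<rparr>"

lemma cring_plucker_ring: "cring (plucker_ring k n)"
proof -
  let ?I = "plucker_index k n"
  let ?P = "{f :: nat set mpoly. \<forall>u\<in>Poly_Mapping.keys f. Poly_Mapping.keys u \<subseteq> ?I}"
  have mult: "f * g \<in> ?P" if f: "f \<in> ?P" and g: "g \<in> ?P" for f g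
  proof (rule CollectI, rule ballI)
    fix w assume "w \<in> Poly_Mapping.keys (f * g)"
    then obtain u v where w: "w = u + v"
      and uv: "u \<in> Poly_Mapping.keys f" "v \<in> Poly_Mapping.keys g"
      using Poly_Mapping.keys_mult[of f g] by (auto dest!: subsetD)
    have "Poly_Mapping.keys u \<union> Poly_Mapping.keys v \<subseteq> ?I" using f g uv by simp
    then show "Poly_Mapping.keys w \<subseteq> ?I"
      unfolding w using Poly_Mapping.keys_add[of u v] by (rule subset_trans[rotated])
  qed
  have add: "f + g \<in> ?P" if f: "f \<in> ?P" and g: "g \<in> ?P" for f g
  proof (rule CollectI, rule ballI)
    fix w assume "w \<in> Poly_Mapping.keys (f + g)"
    then have "w \<in> Poly_Mapping.keys f \<union> Poly_Mapping.keys g"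
      using Poly_Mapping.keys_add[of f g] by (rule rev_subsetD)
    then show "Poly_Mapping.keys w \<subseteq> ?I" using f g by auto
  qed
  have neg: "\<exists>g\<in>?P. g + f = 0" if f: "f \<in> ?P" for f
  proof (rule bexI)
    show "- f + f = 0" by (rule left_minus)
    show "- f \<in> ?P" using f by (simp add: keys_def)
  qed
  have zero: "0 \<in> ?P" and one: "1 \<in> ?P" by simp_all
  have car: "carrier (plucker_ring k n) = ?P"
    and ops: "f \<otimes>\<^bsub>plucker_ring k n\<^esub> g = f * g" "f \<oplus>\<^bsub>plucker_ring k n\<^esub> g = f + g"
      "\<one>\<^bsub>plucker_ring k n\<^esub> = 1" "\<zero>\<^bsub>plucker_ring k n\<^esub> = 0" for f g
    by (simp_all add: plucker_ring_def)
  show ?thesis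
  proof (rule cringI)
    show "abelian_group (plucker_ring k n)"
    proof (rule abelian_groupI, unfold car ops)
      show "f + g \<in> ?P" if "f \<in> ?P" "g \<in> ?P" for f g by (fact add[OF that])
      show "\<exists>g\<in>?P. g + f = 0" if "f \<in> ?P" for f by (fact neg[OF that])
      show "0 \<in> ?P" by (fact zero)
    qed (rule add.assoc add.commute add_0_left)+
    show "comm_monoid (plucker_ring k n)"
    proof (rule comm_monoidI, unfold car ops)
      show "f * g \<in> ?P" if "f \<in> ?P" "g \<in> ?P" for f g by (fact mult[OF that])
      show "1 \<in> ?P" by (fact one)
    qed (rule mult.assoc mult.commute mult_1_left)+
  qed (unfold ops, rule distrib_right)
qed

definition plucker_ideal :: "nat \<Rightarrow> nat \<Rightarrow> nat set mpoly set" where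
  "plucker_ideal k n = Idl\<^bsub>plucker_ring k n\<^esub>
    {f \<in> carrier (plucker_ring k n). (\<exists>e. homogeneous_of_degree e f) \<and>
      (\<forall>W\<in>grassmannian k n. mpoly_eval f (plucker_coords k n W) = 0)}"

subsection \<open>Birational and iterated sequences\<close>

type_synonym root_seq = "(nat \<times> nat) list"

definition positive_roots :: "nat \<Rightarrow> (nat \<times> nat) set" where
  "positive_roots n = {(i, j). i < j \<and> j < n}"

definition root_mat :: "nat \<Rightarrow> nat \<times> nat \<Rightarrow> 'a::comm_ring_1 mat" where
  "root_mat n \<beta> = mat n n (\<lambda>(r, c). if r = snd \<beta> \<and> c = fst \<beta> then 1 else 0)"

definition psi :: "nat \<Rightarrow> root_seq \<Rightarrow> (nat \<Rightarrow> 'a::comm_ring_1) \<Rightarrow> 'a mat" where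
  "psi n S y =
    foldr (*) (map (\<lambda>a. 1\<^sub>m n + y a \<cdot>\<^sub>m root_mat n (S ! a)) [0..<length S]) (1\<^sub>m n)"

definition param_map :: "nat \<Rightarrow> nat \<Rightarrow> root_seq \<Rightarrow> (nat \<Rightarrow> complex) \<Rightarrow> complex vec set" where
  "param_map k n S y = vec_space.col_space n (submatrix (psi n S y) {..<n} {..<k})"

text \<open>Birationality is the existence of an inverse rational map. A rational map from the
  Grassmannian to affine \<open>d\<close>-space is given by \<open>d\<close> quotients \<open>F a / G a\<close> of homogeneous
  polynomials of equal degree in the Pluecker coordinates. The existence of \<open>y\<close> says that
  no \<open>G a\<close> vanishes identically on the Grassmannian and that both compositions are
  defined on nonempty, hence dense, open sets; the last two lines say that both are the
  identity. Points of affine \<open>d\<close>-space are functions of which only the values at \<open>a < d\<close>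
  are used.\<close>

definition birational_seq :: "nat \<Rightarrow> nat \<Rightarrow> root_seq \<Rightarrow> bool" where
  "birational_seq k n S \<longleftrightarrow>
    length S = k * (n - k) \<and> set S \<subseteq> positive_roots n \<and>
    (\<exists>F G.
      (\<forall>a<length S. F a \<in> carrier (plucker_ring k n) \<and> G a \<in> carrier (plucker_ring k n) \<and>
        (\<exists>e. homogeneous_of_degree e (F a) \<and> homogeneous_of_degree e (G a))) \<and>
      (let defined = (\<lambda>W. \<forall>a<length S. mpoly_eval (G a) (plucker_coords k n W) \<noteq> 0);
           inverse_map = (\<lambda>W a. mpoly_eval (F a) (plucker_coords k n W) /
             mpoly_eval (G a) (plucker_coords k n W))
       in (\<exists>y. defined (param_map k n S y)) \<and>
          (\<forall>y. defined (param_map k n S y) \<longrightarrow>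
            (\<forall>a<length S. inverse_map (param_map k n S y) a = y a)) \<and>
          (\<forall>W\<in>grassmannian k n. defined W \<longrightarrow> param_map k n S (inverse_map W) = W)))"

inductive extension_of_birational :: "nat \<Rightarrow> nat \<Rightarrow> root_seq \<Rightarrow> bool" for k :: nat where
  base: "birational_seq k (k + 1) S \<Longrightarrow> extension_of_birational k (k + 1) S"
| extend: "extension_of_birational k m S \<Longrightarrow> length is = k \<Longrightarrow> distinct is \<Longrightarrow>
    set is \<subseteq> {..<m} \<Longrightarrow>
    extension_of_birational k (m + 1) (map (\<lambda>i. (i, m)) is @ S)"

definition iterated_seq :: "nat \<Rightarrow> nat \<Rightarrow> root_seq \<Rightarrow> bool" where
  "iterated_seq k n S \<longleftrightarrow> birational_seq k n S \<and> extension_of_birational k n S"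

subsection \<open>The valuation and its weighting matrix\<close>

text \<open>Elements of \<open>\<int>^d\<close>, \<open>d = length S\<close>, are functions of which only the values at
  \<open>a < d\<close> are used.\<close>

definition height_sum :: "root_seq \<Rightarrow> (nat \<Rightarrow> int) \<Rightarrow> int" where
  "height_sum S m = (\<Sum>a<length S. m a * (int (snd (S ! a)) - int (fst (S ! a))))"

definition lex_greater :: "nat \<Rightarrow> (nat \<Rightarrow> int) \<Rightarrow> (nat \<Rightarrow> int) \<Rightarrow> bool" where
  "lex_greater d m m' \<longleftrightarrow> (\<exists>a<d. m a > m' a \<and> (\<forall>b<a. m b = m' b))"

definition psi_less :: "root_seq \<Rightarrow> (nat \<Rightarrow> int) \<Rightarrow> (nat \<Rightarrow> int) \<Rightarrow> bool" where
  "psi_less S m m' \<longleftrightarrow> height_sum S m < height_sum S m' \<or>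
    (height_sum S m = height_sum S m' \<and> lex_greater (length S) m m')"

definition int_exponent :: "(nat \<Rightarrow>\<^sub>0 nat) \<Rightarrow> nat \<Rightarrow> int" where
  "int_exponent u a = int (Poly_Mapping.lookup u a)"

text \<open>For nonzero \<open>f\<close> in the variables \<open>a < length S\<close> only.\<close>

definition valuation :: "root_seq \<Rightarrow> nat mpoly \<Rightarrow> nat \<Rightarrow> int" where
  "valuation S f = int_exponent (THE u. u \<in> Poly_Mapping.keys f \<and>
    (\<forall>v\<in>Poly_Mapping.keys f. v \<noteq> u \<longrightarrow> psi_less S (int_exponent u) (int_exponent v)))"

definition weighting_matrix :: "nat \<Rightarrow> nat \<Rightarrow> root_seq \<Rightarrow> nat \<Rightarrow> nat set \<Rightarrow> int" where
  "weighting_matrix k n S a J = valuation S (minor k (psi n S mvar) J) a"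

subsection \<open>Initial ideals and the tropical Grassmannian\<close>

definition matrix_times_exponent ::
    "nat \<Rightarrow> nat \<Rightarrow> (nat \<Rightarrow> nat set \<Rightarrow> int) \<Rightarrow> (nat set \<Rightarrow>\<^sub>0 nat) \<Rightarrow> nat \<Rightarrow> int" where
  "matrix_times_exponent k n M u a =
    (\<Sum>J\<in>plucker_index k n. M a J * int (Poly_Mapping.lookup u J))"

definition initial_ideal_matrix ::
    "nat \<Rightarrow> nat \<Rightarrow> root_seq \<Rightarrow> (nat \<Rightarrow> nat set \<Rightarrow> int) \<Rightarrow> nat set mpoly set \<Rightarrow> nat set mpoly set"
  where
  "initial_ideal_matrix k n S M I = Idl\<^bsub>plucker_ring k n\<^esub>
    (initial_form (\<lambda>u v. psi_less S (matrix_times_exponent k n M u)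
      (matrix_times_exponent k n M v)) ` I)"

text \<open>The Euclidean space with coordinates indexed by \<open>plucker_index k n\<close>, as a
  subspace of the normed space of all finitely supported functions.\<close>

definition weight_space :: "nat \<Rightarrow> nat \<Rightarrow> (nat set \<Rightarrow>\<^sub>0 real) set" where
  "weight_space k n = {w. Poly_Mapping.keys w \<subseteq> plucker_index k n}"

definition weight_of :: "nat \<Rightarrow> nat \<Rightarrow> (nat set \<Rightarrow>\<^sub>0 real) \<Rightarrow> (nat set \<Rightarrow>\<^sub>0 nat) \<Rightarrow> real" where
  "weight_of k n w u =
    (\<Sum>J\<in>plucker_index k n. Poly_Mapping.lookup w J * real (Poly_Mapping.lookup u J))"

definition initial_ideal ::
    "nat \<Rightarrow> nat \<Rightarrow> (nat set \<Rightarrow>\<^sub>0 real) \<Rightarrow> nat set mpoly set \<Rightarrow> nat set mpoly set" where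
  "initial_ideal k n w I = Idl\<^bsub>plucker_ring k n\<^esub>
    (initial_form (\<lambda>u v. weight_of k n w u < weight_of k n w v) ` I)"

definition trop_grassmannian :: "nat \<Rightarrow> nat \<Rightarrow> (nat set \<Rightarrow>\<^sub>0 real) set" where
  "trop_grassmannian k n = {w \<in> weight_space k n.
    \<forall>u. Poly_Mapping.single u 1 \<notin> initial_ideal k n w (plucker_ideal k n)}"

text \<open>The (closed) cones of the Groebner fan are the closures of the classes of weight
  vectors with the same initial ideal; these classes are their relative interiors.\<close>

definition groebner_fan :: "nat \<Rightarrow> nat \<Rightarrow> (nat set \<Rightarrow>\<^sub>0 real) set set" where
  "groebner_fan k n =
    {closure {w \<in> weight_space k n.
        initial_ideal k n w (plucker_ideal k n) = initial_ideal k n v (plucker_ideal k n)} |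
      v. v \<in> weight_space k n}"

definition trop_fan :: "nat \<Rightarrow> nat \<Rightarrow> (nat set \<Rightarrow>\<^sub>0 real) set set" where
  "trop_fan k n = {C \<in> groebner_fan k n. C \<subseteq> trop_grassmannian k n}"

end

theory Submission
  imports Defs "Jordan_Normal_Form.DL_Rank_Submatrix"
begin

text \<open>The matrix \<open>M_S\<close> compares exponents through vectors in \<open>\<int>^d\<close>, but on any finite set of vectors
the order \<open>\<prec>_\<Psi>\<close> is the order of a single linear functional \<open>E\<close>: give the height a large
coefficient and let the coordinates enter with negative coefficients whose absolute values
decrease fast enough (\<open>psi_less_weights\<close>). So \<open>w = E M_S\<close> is a real weight that imitates \<open>M_S\<close> on finitely many
exponents, and the proof reduces the assertion to finitely many exponents.

\<^bold>\<open>Both initial ideals agree.\<close> The Pluecker ideal \<open>I\<close> is homogeneous. Refine the weak order given by \<open>M_S\<close>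
to a monomial order. By Dickson's lemma finitely many homogeneous elements \<open>g\<close> of \<open>I\<close> have leading
exponents that generate all leading exponents of \<open>I\<close>. If \<open>w\<close> and \<open>M_S\<close> select the same initial form
of each \<open>g\<close>, then they have the same initial ideal (\<open>init_ideal_eqI\<close>): a homogeneous ideal cannot
properly contain another one with the same leading exponents.

\<^bold>\<open>The weight is tropical.\<close> Birationality makes every minor \<open>P_J\<close> of \<open>\<psi>_S(y)\<close> a nonzero polynomial
(\<open>minor_psi_nonzero\<close>). Let \<open>E\<close> also respect \<open>\<prec>_\<Psi>\<close> on the exponents of these minors. On the curve
\<open>y_a = t^{E_a}\<close> the minor \<open>P_J\<close> becomes \<open>t^{w_J} h_J(t)\<close> with \<open>h_J(0) \<noteq> 0\<close>. An element \<open>f\<close> of \<open>I\<close> vanishes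
along the curve; dividing by the lowest power of \<open>t\<close> and letting \<open>t\<close> tend to \<open>0\<close> shows that \<open>in_w(f)\<close>
vanishes at the point \<open>(h_J(0))_J\<close>, all of whose coordinates are nonzero. Hence \<open>in_w(I)\<close> contains no
monomial.

\<^bold>\<open>The cone.\<close> For a reduced Groebner basis \<open>G\<close>, the weights with the initial ideal of \<open>w\<close> are
exactly those that select the same initial forms of all \<open>g \<in> G\<close>
(\<open>same_init_ideal_conditions\<close>). These are finitely many linear equations and strict linear
inequalities, so the class of \<open>w\<close> is the relative interior of its closure \<open>C\<close>
(\<open>same_init_ideal_rel_interior\<close>). Since the weights whose initial ideal contains a given
monomial form an open set (\<open>no_monomial_closure\<close>), \<open>C\<close> lies in the tropical Grassmannian.\<close>

section \<open>Polynomials and homogeneous ideals\<close>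

abbreviation supp :: "('a \<Rightarrow>\<^sub>0 'b::zero) \<Rightarrow> 'a set" where "supp \<equiv> Poly_Mapping.keys"
abbreviation cf :: "('a \<Rightarrow>\<^sub>0 'b::zero) \<Rightarrow> 'a \<Rightarrow> 'b" where "cf \<equiv> Poly_Mapping.lookup"
abbreviation mterm :: "'a \<Rightarrow> 'b \<Rightarrow> 'a \<Rightarrow>\<^sub>0 'b::zero" where "mterm \<equiv> Poly_Mapping.single"

definition exps :: "'x set \<Rightarrow> ('x \<Rightarrow>\<^sub>0 nat) set" where
  "exps V = {u. supp u \<subseteq> V}"

definition polys :: "'x set \<Rightarrow> 'x mpoly set" where
  "polys V = {f. supp f \<subseteq> exps V}"

definition deg :: "('x \<Rightarrow>\<^sub>0 nat) \<Rightarrow> nat" where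
  "deg u = (\<Sum>x\<in>supp u. cf u x)"

text \<open>Homogeneous components and initial forms are both of this kind.\<close>

definition part :: "(('x \<Rightarrow>\<^sub>0 nat) \<Rightarrow> bool) \<Rightarrow> 'x mpoly \<Rightarrow> 'x mpoly" where
  "part P f = (\<Sum>u\<in>{u \<in> supp f. P u}. mterm u (cf f u))"

lemma cf_part: "cf (part P f) u = (if P u then cf f u else 0)"
proof -
  have "cf (part P f) u = (\<Sum>v\<in>{v \<in> supp f. P v}. if v = u then cf f v else 0)"
    unfolding part_def by (simp add: lookup_sum lookup_single when_def)
  also have "\<dots> = (if P u then cf f u else 0)"
    by (auto simp: sum.delta in_keys_iff)
  finally show ?thesis .
qed

lemma supp_part: "supp (part P f) = {u \<in> supp f. P u}"
  by (auto simp: in_keys_iff cf_part split: if_splits)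

lemma part_eqI: "(\<And>u. P u \<Longrightarrow> cf f u = cf g u) \<Longrightarrow> (\<And>u. \<not> P u \<Longrightarrow> cf g u = 0) \<Longrightarrow> part P f = g"
  by (rule poly_mapping_eqI) (auto simp: cf_part)

lemma initial_form_part: "initial_form lt f = part (\<lambda>u. \<forall>v\<in>supp f. \<not> lt v u) f"
  unfolding initial_form_def part_def ..

lemma mpoly_eq_sum_monoms:
  fixes f :: "'x mpoly"
  shows "f = (\<Sum>v\<in>supp f. mterm v (cf f v))"
proof -
  have "part (\<lambda>_. True) f = f" by (rule part_eqI) auto
  then have "(\<Sum>v\<in>supp f. mterm v (cf f v)) = f" by (simp only: part_def simp_thms Collect_mem_eq)
  then show ?thesis by (rule sym)
qed

lemma cf_monom_times_add:
  fixes f :: "'x mpoly" and w :: "'x \<Rightarrow>\<^sub>0 nat"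
  shows "cf (mterm s c * f) (s + u) = c * cf f u"
    and "(\<And>u. w \<noteq> s + u) \<Longrightarrow> cf (mterm s c * f) w = 0"
proof -
  have eq: "mterm s c * f = (\<Sum>v\<in>supp f. mterm (s + v) (c * cf f v))"
    using arg_cong[OF mpoly_eq_sum_monoms[of f], of "(*) (mterm s c)"]
    by (simp add: sum_distrib_left mult_single)
  have "cf (mterm s c * f) (s + u) = (\<Sum>v\<in>supp f. if v = u then c * cf f v else 0)"
    unfolding eq by (simp add: lookup_sum lookup_single when_def)
  then show "cf (mterm s c * f) (s + u) = c * cf f u"
    by (auto simp: sum.delta in_keys_iff)
  show "cf (mterm s c * f) w = 0" if "\<And>u. w \<noteq> s + u"
  proof -
    have "cf (mterm (s + v) (c * cf f v)) w = 0" for v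
      using that[of v] by (simp add: lookup_single)
    then show ?thesis unfolding eq lookup_sum by simp
  qed
qed

lemma supp_monom_times:
  fixes f :: "'x mpoly"
  shows "w \<in> supp (mterm s c * f) \<longleftrightarrow> c \<noteq> 0 \<and> (\<exists>u\<in>supp f. w = s + u)"
proof (cases "\<exists>u. w = s + u")
  case True
  then show ?thesis by (auto simp: in_keys_iff cf_monom_times_add(1))
next
  case False
  then show ?thesis using cf_monom_times_add(2)[of w s c f] by (auto simp: in_keys_iff)
qed

lemma exps_add: "u \<in> exps V \<Longrightarrow> v \<in> exps V \<Longrightarrow> u + v \<in> exps V"
  unfolding exps_def using Poly_Mapping.keys_add[of u v] by auto

lemma exps_zero: "0 \<in> exps V"
  by (simp add: exps_def)

lemma deg_on: assumes "u \<in> exps V" "finite V" shows "deg u = (\<Sum>x\<in>V. cf u x)"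
  unfolding deg_def using assms by (intro sum.mono_neutral_left) (auto simp: exps_def in_keys_iff)

lemma deg_add: "deg (u + v) = deg u + deg v"
proof -
  let ?V = "supp u \<union> supp v"
  have *: "u \<in> exps ?V" "v \<in> exps ?V" "u + v \<in> exps ?V"
    using Poly_Mapping.keys_add[of u v] by (auto simp: exps_def)
  show ?thesis
    using *[THEN deg_on] by (simp add: lookup_add sum.distrib)
qed

lemma finite_exps_deg_le:
  assumes "finite V" shows "finite {u \<in> exps V. deg u \<le> e}"
proof -
  let ?F = "{f. \<forall>x. (x \<in> V \<longrightarrow> f x \<in> {..e}) \<and> (x \<notin> V \<longrightarrow> f x = (0::nat))}"
  have "finite ?F" using assms by (intro finite_set_of_finite_funs) simp_all
  moreover have "cf ` {u \<in> exps V. deg u \<le> e} \<subseteq> ?F"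
  proof (clarsimp, intro conjI impI)
    fix u x assume u: "u \<in> exps V" "deg u \<le> e" and x: "x \<in> V"
    have "cf u x \<le> (\<Sum>x\<in>V. cf u x)" using assms x by (simp add: member_le_sum)
    then show "cf u x \<le> e" using u deg_on[OF u(1) assms] by simp
  next
    fix u x assume u: "u \<in> exps V" "deg u \<le> e" and x: "x \<notin> V"
    then show "cf u x = 0" by (auto simp: exps_def in_keys_iff)
  qed
  ultimately show ?thesis
    by (meson finite_subset finite_imageD inj_on_def lookup_inject)
qed

lemma polysD: "f \<in> polys V \<Longrightarrow> u \<in> supp f \<Longrightarrow> u \<in> exps V"
  by (auto simp: polys_def)

lemma polys_zero: "0 \<in> polys V" by (simp add: polys_def)

lemma polys_add: "f \<in> polys V \<Longrightarrow> g \<in> polys V \<Longrightarrow> f + g \<in> polys V"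
  unfolding polys_def using Poly_Mapping.keys_add[of f g] by auto

lemma polys_part: "f \<in> polys V \<Longrightarrow> part P f \<in> polys V"
  unfolding polys_def by (auto simp: supp_part)

lemma polys_monom: "u \<in> exps V \<Longrightarrow> mterm u c \<in> polys V"
  unfolding polys_def by auto

lemma polys_monom_times: "f \<in> polys V \<Longrightarrow> s \<in> exps V \<Longrightarrow> mterm s c * f \<in> polys V"
  unfolding polys_def by (auto simp: supp_monom_times intro!: exps_add)

text \<open>For sets of polynomials in the variables \<open>V\<close> this is the usual notion of an ideal, since every
polynomial is a sum of terms; multiplication by terms is what division by leading terms uses.\<close>

definition poly_ideal :: "'x set \<Rightarrow> 'x mpoly set \<Rightarrow> bool" where
  "poly_ideal V X \<longleftrightarrow> X \<subseteq> polys V \<and> 0 \<in> X \<and> (\<forall>f\<in>X. \<forall>g\<in>X. f + g \<in> X) \<and>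
     (\<forall>f\<in>X. \<forall>s\<in>exps V. \<forall>c. mterm s c * f \<in> X)"

lemma poly_idealD:
  assumes "poly_ideal V X"
  shows "f \<in> X \<Longrightarrow> f \<in> polys V" "0 \<in> X" "f \<in> X \<Longrightarrow> g \<in> X \<Longrightarrow> f + g \<in> X"
    "f \<in> X \<Longrightarrow> s \<in> exps V \<Longrightarrow> mterm s c * f \<in> X"
  using assms unfolding poly_ideal_def by auto

lemma poly_ideal_diff:
  assumes X: "poly_ideal V X" and "f \<in> X" "g \<in> X" shows "f - g \<in> X"
proof -
  have "mterm 0 (-1) * g \<in> X" using poly_idealD(4)[OF X assms(3)] exps_zero by blast
  moreover have "mterm 0 (-1) * g = - g"
  proof -
    have "mterm 0 (-1) = (- 1 :: 'a mpoly)" by (metis single_uminus single_one)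
    then show ?thesis by simp
  qed
  ultimately show ?thesis using poly_idealD(3)[OF X assms(2)] by fastforce
qed

lemma poly_ideal_sum:
  assumes X: "poly_ideal V X" and "\<And>i. i \<in> A \<Longrightarrow> f i \<in> X" shows "sum f A \<in> X"
  using assms(2) by (induction A rule: infinite_finite_induct) (auto intro: poly_idealD[OF X])

definition ideal_gen :: "'x set \<Rightarrow> 'x mpoly set \<Rightarrow> 'x mpoly set" where
  "ideal_gen V A = \<Inter>{X. poly_ideal V X \<and> A \<subseteq> X}"

lemma poly_ideal_polys: "poly_ideal V (polys V)"
  unfolding poly_ideal_def by (auto intro: polys_zero polys_add polys_monom_times)

lemma ideal_gen_subset: "A \<subseteq> ideal_gen V A" by (auto simp: ideal_gen_def)

lemma ideal_gen_least: "poly_ideal V X \<Longrightarrow> A \<subseteq> X \<Longrightarrow> ideal_gen V A \<subseteq> X" by (auto simp: ideal_gen_def)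

lemma poly_ideal_ideal_gen: assumes "A \<subseteq> polys V" shows "poly_ideal V (ideal_gen V A)"
proof -
  have "ideal_gen V A \<subseteq> polys V" using assms poly_ideal_polys by (rule ideal_gen_least[rotated])
  then show ?thesis unfolding poly_ideal_def by (auto simp: ideal_gen_def poly_ideal_def)
qed

definition graded :: "'x mpoly set \<Rightarrow> bool" where
  "graded X \<longleftrightarrow> (\<forall>f\<in>X. \<forall>e. part (\<lambda>u. deg u = e) f \<in> X)"

definition homogeneous :: "'x mpoly \<Rightarrow> bool" where
  "homogeneous f \<longleftrightarrow> (\<exists>e. \<forall>u\<in>supp f. deg u = e)"

lemma part_homogeneous: "homogeneous f \<Longrightarrow> part (\<lambda>u. deg u = e) f = f \<or> part (\<lambda>u. deg u = e) f = 0"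
proof -
  assume "homogeneous f"
  then obtain d where d: "\<And>u. u \<in> supp f \<Longrightarrow> deg u = d" by (auto simp: homogeneous_def)
  show ?thesis
  proof (cases "d = e")
    case True
    then have "part (\<lambda>u. deg u = e) f = f" using d by (intro part_eqI) (auto simp: in_keys_iff)
    then show ?thesis ..
  next
    case False
    then have "part (\<lambda>u. deg u = e) f = 0" using d
      by (intro part_eqI) (force simp: in_keys_iff)+
    then show ?thesis ..
  qed
qed

lemma part_add: "part P (f + g) = part P f + part P g"
  by (rule poly_mapping_eqI) (simp add: cf_part lookup_add)

lemma part_zero: "part P 0 = 0"
  by (rule poly_mapping_eqI) (simp add: cf_part)

text \<open>It suffices to control the components of generators, because multiplying by a term
of exponent \<open>s\<close> shifts the degree by \<open>deg s\<close>.\<close>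

lemma ideal_gen_graded:
  fixes A :: "'x mpoly set"
  assumes A: "A \<subseteq> polys V" and gr: "\<And>f e. f \<in> A \<Longrightarrow> part (\<lambda>u. deg u = e) f \<in> ideal_gen V A"
  shows "graded (ideal_gen V A)"
proof -
  note G = poly_ideal_ideal_gen[OF A]
  let ?X = "{f \<in> polys V. \<forall>e. part (\<lambda>u. deg u = e) f \<in> ideal_gen V A}"
  have "poly_ideal V ?X"
    unfolding poly_ideal_def
  proof (intro conjI ballI allI)
    show "0 \<in> ?X" by (simp add: polys_zero part_zero poly_idealD[OF G])
    show "f + g \<in> ?X" if "f \<in> ?X" "g \<in> ?X" for f g
      using that by (simp add: polys_add part_add poly_idealD[OF G])
    show "mterm s c * f \<in> ?X" if f: "f \<in> ?X" and s: "s \<in> exps V" for f s c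
    proof -
      have "part (\<lambda>u. deg u = e) (mterm s c * f) \<in> ideal_gen V A" for e
      proof (cases "deg s \<le> e")
        case True
        have "part (\<lambda>u. deg u = e) (mterm s c * f) = mterm s c * part (\<lambda>u. deg u = e - deg s) f"
        proof (rule part_eqI)
          fix w :: "'x \<Rightarrow>\<^sub>0 nat" assume "deg w = e"
          then show "cf (mterm s c * f) w = cf (mterm s c * part (\<lambda>u. deg u = e - deg s) f) w"
            by (cases "\<exists>u. w = s + u") (auto simp: cf_monom_times_add cf_part deg_add)
        next
          fix w :: "'x \<Rightarrow>\<^sub>0 nat" assume "deg w \<noteq> e"
          then show "cf (mterm s c * part (\<lambda>u. deg u = e - deg s) f) w = 0"
            using True by (cases "\<exists>u. w = s + u") (auto simp: cf_monom_times_add cf_part deg_add)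
        qed
        then show ?thesis using f s poly_idealD(4)[OF G] by auto
      next
        case False
        have "part (\<lambda>u. deg u = e) (mterm s c * f) = 0"
        proof (rule part_eqI)
          fix w :: "'x \<Rightarrow>\<^sub>0 nat" assume "deg w = e"
          then show "cf (mterm s c * f) w = cf 0 w"
            using False by (cases "\<exists>u. w = s + u") (auto simp: cf_monom_times_add deg_add)
        qed simp
        then show ?thesis using poly_idealD(2)[OF G] by simp
      qed
      then show ?thesis using f s polys_monom_times by blast
    qed
  qed auto
  moreover have "A \<subseteq> ?X" using A gr by auto
  ultimately have "ideal_gen V A \<subseteq> ?X" by (rule ideal_gen_least)
  then show ?thesis by (auto simp: graded_def)
qed

lemma ideal_gen_homogeneous_graded:
  assumes A: "A \<subseteq> polys V" and hom: "\<And>f. f \<in> A \<Longrightarrow> homogeneous f"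
  shows "graded (ideal_gen V A)"
proof (rule ideal_gen_graded[OF A])
  fix f e assume f: "f \<in> A"
  show "part (\<lambda>u. deg u = e) f \<in> ideal_gen V A"
    using part_homogeneous[OF hom[OF f], of e] f ideal_gen_subset[of A V] poly_idealD(2)[OF poly_ideal_ideal_gen[OF A]] by auto
qed

section \<open>Leading exponents and normal forms\<close>

definition is_lead :: "(('x \<Rightarrow>\<^sub>0 nat) \<Rightarrow> ('x \<Rightarrow>\<^sub>0 nat) \<Rightarrow> bool) \<Rightarrow> 'x mpoly \<Rightarrow> ('x \<Rightarrow>\<^sub>0 nat) \<Rightarrow> bool" where
  "is_lead ls f m \<longleftrightarrow> m \<in> supp f \<and> (\<forall>v\<in>supp f. v \<noteq> m \<longrightarrow> ls m v)"

definition leads :: "(('x \<Rightarrow>\<^sub>0 nat) \<Rightarrow> ('x \<Rightarrow>\<^sub>0 nat) \<Rightarrow> bool) \<Rightarrow> 'x mpoly set \<Rightarrow> ('x \<Rightarrow>\<^sub>0 nat) set" where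
  "leads ls X = {m. \<exists>f\<in>X. is_lead ls f m}"

text \<open>Leading exponents are the least ones, as initial forms collect the terms of minimal weight. Weights of
any sign occur, so it is not well-foundedness that makes division terminate, but the fact
that a homogeneous ideal keeps it among the finitely many exponents of bounded degree.\<close>

locale monomial_order =
  fixes V :: "'x set" and ls :: "('x \<Rightarrow>\<^sub>0 nat) \<Rightarrow> ('x \<Rightarrow>\<^sub>0 nat) \<Rightarrow> bool"
  assumes finite_vars: "finite V"
    and ls_irrefl: "\<not> ls u u"
    and ls_trans: "ls u v \<Longrightarrow> ls v w \<Longrightarrow> ls u w"
    and ls_total: "u \<in> exps V \<Longrightarrow> v \<in> exps V \<Longrightarrow> u \<noteq> v \<Longrightarrow> ls u v \<or> ls v u"
    and ls_add: "ls u v \<Longrightarrow> ls (s + u) (s + v)"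
begin

lemma ex_least:
  assumes "finite B" "B \<noteq> {}" "B \<subseteq> exps V"
  shows "\<exists>m\<in>B. \<forall>v\<in>B. v \<noteq> m \<longrightarrow> ls m v"
  using assms
proof (induction B rule: finite_ne_induct)
  case (insert x F)
  then obtain m where m: "m \<in> F" "\<forall>v\<in>F. v \<noteq> m \<longrightarrow> ls m v" by auto
  have "x \<noteq> m" "x \<in> exps V" "m \<in> exps V" using insert m by auto
  then consider "ls x m" | "ls m x" using ls_total by blast
  then show ?case
  proof cases
    case 1
    then have "\<forall>v\<in>insert x F. v \<noteq> x \<longrightarrow> ls x v" using m 1 ls_trans[OF 1] by auto
    then show ?thesis by blast
  next
    case 2
    then show ?thesis using m by blast
  qed
qed simp

lemma ex_lead: "f \<in> polys V \<Longrightarrow> f \<noteq> 0 \<Longrightarrow> \<exists>m. is_lead ls f m"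
  using ex_least[of "supp f"] unfolding is_lead_def polys_def by auto

lemma leads_exps: "X \<subseteq> polys V \<Longrightarrow> leads ls X \<subseteq> exps V"
  by (auto simp: leads_def is_lead_def polys_def)

text \<open>A nonzero element of \<open>X\<close> would have its leading exponent in its support.\<close>

lemma no_leads_zero:
  assumes "X \<subseteq> polys V" "f \<in> X" "supp f \<inter> leads ls X = {}" shows "f = 0"
proof (rule ccontr)
  assume "f \<noteq> 0"
  then obtain m where "is_lead ls f m" using ex_lead assms by blast
  then show False using assms by (auto simp: leads_def is_lead_def)
qed

lemma leads_up:
  assumes X: "poly_ideal V X" and "m \<in> leads ls X" "s \<in> exps V"
  shows "s + m \<in> leads ls X"
proof -
  obtain f where f: "f \<in> X" "is_lead ls f m" using assms by (auto simp: leads_def)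
  have "is_lead ls (mterm s 1 * f) (s + m)"
    using f(2) unfolding is_lead_def by (auto simp: supp_monom_times ls_add)
  then show ?thesis using poly_idealD(4)[OF X f(1) assms(3)] by (auto simp: leads_def)
qed

lemma leads_homogeneous:
  assumes X: "graded X" and "m \<in> leads ls X"
  shows "\<exists>f\<in>X. is_lead ls f m \<and> (\<forall>u\<in>supp f. deg u = deg m)"
proof -
  obtain f where f: "f \<in> X" "is_lead ls f m" using assms by (auto simp: leads_def)
  have "is_lead ls (part (\<lambda>u. deg u = deg m) f) m"
    using f(2) by (auto simp: is_lead_def supp_part)
  then show ?thesis using X f by (auto simp: graded_def supp_part intro!: bexI[of _ "part (\<lambda>u. deg u = deg m) f"])
qed

text \<open>Division with remainder. All exponents of \<open>f\<close> have degree at most \<open>d\<close>, and subtracting multiples of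
homogeneous elements of \<open>X\<close> stays within the finite set \<open>Fin\<close> of such exponents. Clearing the least
exponent in \<open>leads ls X\<close> introduces only larger ones, so the set \<open>B\<close> of those
that may still occur loses one element per step.\<close>

lemma normal_form:
  assumes X: "poly_ideal V X" and gr: "graded X" and f: "f \<in> polys V"
  shows "\<exists>r\<in>polys V. f - r \<in> X \<and> supp r \<inter> leads ls X = {}"
proof -
  define d where "d = (\<Sum>u\<in>supp f. deg u)"
  define Fin where "Fin = {u \<in> exps V. deg u \<le> d}"
  let ?L = "leads ls X"
  have fin: "finite Fin" unfolding Fin_def by (rule finite_exps_deg_le[OF finite_vars])
  have fF: "supp f \<subseteq> Fin"
    using polysD[OF f] by (auto simp: Fin_def d_def intro: member_le_sum)
  have main: "\<exists>r. supp r \<subseteq> Fin \<and> f - r \<in> X \<and> supp r \<inter> ?L = {}"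
    if "card B = n" "B \<subseteq> Fin \<inter> ?L" "\<And>u v. u \<in> B \<Longrightarrow> v \<in> Fin \<inter> ?L \<Longrightarrow> ls u v \<Longrightarrow> v \<in> B"
      "supp f \<subseteq> Fin" "supp f \<inter> ?L \<subseteq> B" for n B f
    using that
  proof (induction n arbitrary: B f)
    case 0
    then have "B = {}" using fin by (meson card_eq_0_iff finite_Int finite_subset)
    then have "supp f \<inter> ?L = {}" using 0 by auto
    then show ?case using 0 poly_idealD(2)[OF X] by (intro exI[of _ f]) auto
  next
    case (Suc n)
    have "finite B" "B \<noteq> {}" "B \<subseteq> exps V" using Suc.prems fin by (auto simp: Fin_def intro: finite_subset)
    then obtain m where m: "m \<in> B" "\<And>v. v \<in> B \<Longrightarrow> v \<noteq> m \<Longrightarrow> ls m v" using ex_least by meson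
    then have "m \<in> ?L" and mF: "m \<in> Fin" using Suc.prems by auto
    then obtain g where g: "g \<in> X" "is_lead ls g m" "\<And>u. u \<in> supp g \<Longrightarrow> deg u = deg m"
      using leads_homogeneous[OF gr] by meson
    have gF: "supp g \<subseteq> Fin" using g mF polysD[OF poly_idealD(1)[OF X g(1)]] by (auto simp: Fin_def)
    have gm: "cf g m \<noteq> 0" using g(2) by (auto simp: is_lead_def in_keys_iff)
    define h where "h = mterm 0 (cf f m / cf g m) * g"
    have h: "h \<in> X" unfolding h_def using poly_idealD(4)[OF X g(1) exps_zero] .
    have ch: "cf h u = cf f m / cf g m * cf g u" for u
      unfolding h_def using cf_monom_times_add(1)[of 0 _ g u] by simp
    have sh: "supp h \<subseteq> supp g" by (auto simp: in_keys_iff ch)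
    have sfh: "supp (f - h) \<subseteq> supp f \<union> supp h" by (rule keys_diff)
    have fm: "m \<notin> supp (f - h)" using gm by (simp add: in_keys_iff lookup_minus ch)
    have "\<exists>r. supp r \<subseteq> Fin \<and> (f - h) - r \<in> X \<and> supp r \<inter> ?L = {}"
    proof (rule Suc.IH)
      show "card (B - {m}) = n" using Suc.prems(1) m(1) \<open>finite B\<close> by simp
      show "B - {m} \<subseteq> Fin \<inter> ?L" using Suc.prems(2) by auto
      show "v \<in> B - {m}" if "u \<in> B - {m}" "v \<in> Fin \<inter> ?L" "ls u v" for u v
        using that Suc.prems(3)[of u v] m(2)[of u] ls_trans ls_irrefl by auto
      show "supp (f - h) \<subseteq> Fin" using sfh sh gF Suc.prems(4) by auto
      show "supp (f - h) \<inter> ?L \<subseteq> B - {m}"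
      proof
        fix v assume v: "v \<in> supp (f - h) \<inter> ?L"
        then have vm: "v \<noteq> m" using fm by auto
        consider "v \<in> supp f" | "v \<in> supp g" using v sfh sh by auto
        then have "v \<in> B"
        proof cases
          case 1 then show ?thesis using v Suc.prems(5) by auto
        next
          case 2
          then have "ls m v" using g(2) vm by (auto simp: is_lead_def)
          then show ?thesis using Suc.prems(3)[OF m(1)] v 2 gF by auto
        qed
        then show "v \<in> B - {m}" using vm by simp
      qed
    qed
    then obtain r where r: "supp r \<subseteq> Fin" "f - h - r \<in> X" "supp r \<inter> ?L = {}" by auto
    have "f - r = (f - h - r) + h" by simp
    then have "f - r \<in> X" using poly_idealD(3)[OF X r(2) h] by simp
    then show ?case using r by auto
  qed
  obtain r where "supp r \<subseteq> Fin" "f - r \<in> X" "supp r \<inter> ?L = {}"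
    using main[of "Fin \<inter> ?L" _ f] fF by blast
  then show ?thesis unfolding Fin_def polys_def by blast
qed

text \<open>The remainder of an element of \<open>X\<close> modulo \<open>Y\<close> is again in \<open>X\<close> and has no exponent in \<open>leads ls X\<close>,
so it is zero.\<close>

lemma ideal_eq_if_leads:
  assumes X: "poly_ideal V X" and Y: "poly_ideal V Y" "graded Y" and "Y \<subseteq> X"
    and L: "leads ls X \<subseteq> leads ls Y"
  shows "X = Y"
proof
  show "X \<subseteq> Y"
  proof
    fix f assume f: "f \<in> X"
    obtain r where r: "f - r \<in> Y" "supp r \<inter> leads ls Y = {}"
      using normal_form[OF Y poly_idealD(1)[OF X f]] by auto
    have "f - (f - r) \<in> X" using poly_ideal_diff[OF X f] r assms(4) by blast
    then have "r \<in> X" by simp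
    then have "r = 0" using r(2) L X by (intro no_leads_zero[of X]) (auto simp: poly_ideal_def)
    then show "f \<in> Y" using r by simp
  qed
qed fact

text \<open>The monomial with exponent \<open>m\<close> minus its normal form; its component of the degree of \<open>m\<close> is
homogeneous and still contains \<open>m\<close>.\<close>

lemma reduced_element:
  assumes X: "poly_ideal V X" and gr: "graded X" and m: "m \<in> leads ls X"
  shows "\<exists>g\<in>X. homogeneous g \<and> supp g \<inter> leads ls X = {m}"
proof -
  have mV: "m \<in> exps V" using m leads_exps X by (auto simp: poly_ideal_def)
  then obtain r where r: "mterm m 1 - r \<in> X" "supp r \<inter> leads ls X = {}"
    using normal_form[OF X gr polys_monom[OF mV, of 1]] by auto
  let ?g = "part (\<lambda>u. deg u = deg m) (mterm m 1 - r)"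
  have "m \<notin> supp r" using r m by auto
  then have "m \<in> supp ?g" by (simp add: supp_part in_keys_iff lookup_minus)
  moreover have "supp ?g \<subseteq> insert m (supp r)"
    using keys_diff[of "mterm m 1" r] by (auto simp: supp_part split: if_splits)
  moreover have "?g \<in> X" using gr r by (auto simp: graded_def)
  moreover have "homogeneous ?g" by (auto simp: homogeneous_def supp_part)
  ultimately show ?thesis using r m by (intro bexI[of _ ?g]) auto
qed

lemma lead_of_reduced:
  assumes X: "X \<subseteq> polys V" and "g \<in> X" "supp g \<inter> leads ls X = {m}"
  shows "is_lead ls g m"
proof -
  have "g \<noteq> 0" using assms by auto
  then obtain b where b: "is_lead ls g b" using ex_lead X assms(2) by blast
  then have "b \<in> supp g \<inter> leads ls X" using assms by (auto simp: leads_def is_lead_def)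
  then show ?thesis using assms b by auto
qed

end

section \<open>Initial ideals of weak orders\<close>

text \<open>A weak order on exponents that is invariant under translation. Two exponents have equal weight if
neither is below the other; \<open>lt_negtrans\<close> makes this relation transitive.\<close>

locale weight_order =
  fixes lt :: "('x \<Rightarrow>\<^sub>0 nat) \<Rightarrow> ('x \<Rightarrow>\<^sub>0 nat) \<Rightarrow> bool"
  assumes lt_irrefl: "\<not> lt u u"
    and lt_trans: "lt u v \<Longrightarrow> lt v w \<Longrightarrow> lt u w"
    and lt_negtrans: "lt u w \<Longrightarrow> lt u v \<or> lt v w"
    and lt_add: "lt (s + u) (s + v) \<longleftrightarrow> lt u v"

definition refine :: "('a \<Rightarrow> 'a \<Rightarrow> bool) \<Rightarrow> ('a \<Rightarrow> 'a \<Rightarrow> bool) \<Rightarrow> 'a \<Rightarrow> 'a \<Rightarrow> bool" where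
  "refine tb lt u v \<longleftrightarrow> lt u v \<or> (\<not> lt v u \<and> tb u v)"

lemma monomial_order_refine:
  assumes "monomial_order V tb" and "weight_order lt"
  shows "monomial_order V (refine tb lt)"
proof -
  interpret t: monomial_order V tb by fact
  interpret w: weight_order lt by fact
  show ?thesis
  proof
    show "finite V" by (fact t.finite_vars)
    show "\<not> refine tb lt u u" for u using t.ls_irrefl w.lt_irrefl by (auto simp: refine_def)
    show "refine tb lt u w" if "refine tb lt u v" "refine tb lt v w" for u v w
      using that t.ls_trans w.lt_trans w.lt_negtrans unfolding refine_def by metis
    show "refine tb lt u v \<or> refine tb lt v u" if "u \<in> exps V" "v \<in> exps V" "u \<noteq> v" for u v
      using t.ls_total[OF that] by (auto simp: refine_def)
    show "refine tb lt (s + u) (s + v)" if "refine tb lt u v" for s u v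
      using that t.ls_add w.lt_add by (auto simp: refine_def)
  qed
qed

text \<open>The initial ideal for an arbitrary strict order on exponents; the initial ideals of the weighting matrix
and of real weights are instances.\<close>

definition init_ideal :: "'x set \<Rightarrow> (('x \<Rightarrow>\<^sub>0 nat) \<Rightarrow> ('x \<Rightarrow>\<^sub>0 nat) \<Rightarrow> bool) \<Rightarrow> 'x mpoly set \<Rightarrow> 'x mpoly set" where
  "init_ideal V lt I = ideal_gen V (initial_form lt ` I)"

lemma supp_initial_form: "supp (initial_form lt f) = {u \<in> supp f. \<forall>v\<in>supp f. \<not> lt v u}"
  by (simp add: initial_form_part supp_part)

lemma cf_initial_form: "u \<in> supp (initial_form lt f) \<Longrightarrow> cf (initial_form lt f) u = cf f u"
  by (simp add: initial_form_part supp_part cf_part)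

lemma initial_forms_polys: "I \<subseteq> polys V \<Longrightarrow> initial_form lt ` I \<subseteq> polys V"
  by (auto simp: initial_form_part intro: polys_part)

lemma poly_ideal_init_ideal: "I \<subseteq> polys V \<Longrightarrow> poly_ideal V (init_ideal V lt I)"
  unfolding init_ideal_def by (intro poly_ideal_ideal_gen initial_forms_polys)

lemma initial_form_in_init_ideal: "f \<in> I \<Longrightarrow> initial_form lt f \<in> init_ideal V lt I"
  unfolding init_ideal_def using ideal_gen_subset by blast

lemma is_lead_initial_form:
  assumes "weight_order lt" "is_lead (refine tb lt) f m"
  shows "is_lead tb (initial_form lt f) m"
proof -
  interpret w: weight_order lt by fact
  have m: "m \<in> supp f" "\<And>v. v \<in> supp f \<Longrightarrow> v \<noteq> m \<Longrightarrow> refine tb lt m v"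
    using assms(2) by (auto simp: is_lead_def)
  have "\<not> lt v m" if "v \<in> supp f" for v
    using m(2)[OF that] w.lt_irrefl w.lt_trans[of v m v] by (cases "v = m") (auto simp: refine_def)
  then show ?thesis using m by (auto simp: is_lead_def supp_initial_form refine_def)
qed

text \<open>The part of an element \<open>h\<close> of the initial ideal that lies in one weight class, that of \<open>u\<close>, is the
lowest part of some \<open>f\<close> in \<open>I\<close>, or zero. The \<open>h\<close> with this property, for all \<open>u\<close>, form an ideal:
the lowest parts are all taken with respect to the same class, so they may be added even if they
cancel. Every initial form has the property.\<close>

lemma init_ideal_classes:
  assumes "weight_order lt" and I: "poly_ideal V I" and h: "h \<in> init_ideal V lt I"
  shows "\<exists>f\<in>I. (\<forall>v\<in>supp f. \<not> lt v u) \<and> (\<forall>v. \<not> lt u v \<and> \<not> lt v u \<longrightarrow> cf f v = cf h v)"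
proof -
  interpret w: weight_order lt by fact
  define good where "good = (\<lambda>h u f. f \<in> I \<and> (\<forall>v\<in>supp f. \<not> lt v u) \<and>
    (\<forall>v. \<not> lt u v \<and> \<not> lt v u \<longrightarrow> cf f v = cf h v))"
  let ?Z = "{h \<in> polys V. \<forall>u. \<exists>f. good h u f}"
  have IV: "I \<subseteq> polys V" using I by (simp add: poly_ideal_def)
  have "poly_ideal V ?Z"
    unfolding poly_ideal_def
  proof (intro conjI ballI allI)
    have "good 0 u 0" for u using poly_idealD(2)[OF I] by (simp add: good_def)
    then show "0 \<in> ?Z" by (auto simp: polys_zero)
    show "h + h' \<in> ?Z" if hh: "h \<in> ?Z" "h' \<in> ?Z" for h h'
    proof -
      have "\<exists>f. good (h + h') u f" for u
      proof -
        obtain f f' where f: "good h u f" "good h' u f'" using hh by blast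
        have "good (h + h') u (f + f')"
          using f Poly_Mapping.keys_add[of f f'] poly_idealD(3)[OF I]
          by (auto simp: good_def lookup_add)
        then show ?thesis ..
      qed
      then show ?thesis using hh by (auto simp: polys_add)
    qed
    show "mterm s c * h \<in> ?Z" if h: "h \<in> ?Z" and s: "s \<in> exps V" for h s c
    proof -
      have "\<exists>f. good (mterm s c * h) u f" for u
      proof (cases "\<exists>v. \<not> lt u (s + v) \<and> \<not> lt (s + v) u")
        case True
        then obtain v where v: "\<not> lt u (s + v)" "\<not> lt (s + v) u" by blast
        obtain f where f: "good h v f" using h by blast
        have "good (mterm s c * h) u (mterm s c * f)"
          unfolding good_def
        proof (intro conjI ballI allI impI)
          show "mterm s c * f \<in> I" using f s poly_idealD(4)[OF I] by (auto simp: good_def)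
          fix z assume "z \<in> supp (mterm s c * f)"
          then obtain z' where z: "z' \<in> supp f" "z = s + z'" by (auto simp: supp_monom_times)
          then have "\<not> lt z (s + v)" using f by (auto simp: good_def w.lt_add)
          then show "\<not> lt z u" using w.lt_negtrans v by blast
        next
          fix z assume z: "\<not> lt u z \<and> \<not> lt z u"
          show "cf (mterm s c * f) z = cf (mterm s c * h) z"
          proof (cases "\<exists>z'. z = s + z'")
            case True
            then obtain z' where z': "z = s + z'" ..
            have "\<not> lt (s + z') (s + v)" "\<not> lt (s + v) (s + z')"
              using z v w.lt_negtrans unfolding z' by blast+
            then have "cf f z' = cf h z'" using f by (auto simp: good_def w.lt_add)
            then show ?thesis by (simp add: z' cf_monom_times_add)
          next
            case False
            then show ?thesis by (simp add: cf_monom_times_add)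
          qed
        qed
        then show ?thesis ..
      next
        case False
        have "good (mterm s c * h) u 0"
          unfolding good_def
        proof (intro conjI ballI allI impI)
          fix z assume z: "\<not> lt u z \<and> \<not> lt z u"
          then have "\<And>z'. z \<noteq> s + z'" using False by blast
          then show "cf 0 z = cf (mterm s c * h) z" by (simp add: cf_monom_times_add)
        qed (auto simp: poly_idealD[OF I])
        then show ?thesis ..
      qed
      then show ?thesis using h s polys_monom_times by blast
    qed
  qed auto
  moreover have "initial_form lt ` I \<subseteq> ?Z"
  proof
    fix h assume "h \<in> initial_form lt ` I"
    then obtain f where f: "f \<in> I" "h = initial_form lt f" by auto
    have "\<exists>f'. good h u f'" for u
    proof (cases "\<exists>v\<in>supp h. \<not> lt u v \<and> \<not> lt v u")
      case True
      then obtain v where v: "v \<in> supp f" "\<And>z. z \<in> supp f \<Longrightarrow> \<not> lt z v" "\<not> lt u v" "\<not> lt v u"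
        by (auto simp: f supp_initial_form)
      have 1: "\<not> lt z u" if "z \<in> supp f" for z using v that w.lt_negtrans by blast
      have 2: "cf f z = cf h z" if z: "\<not> lt u z" "\<not> lt z u" for z
      proof -
        have "\<forall>x\<in>supp f. \<not> lt x z" using 1 z w.lt_negtrans by blast
        then show ?thesis by (simp add: f initial_form_part cf_part)
      qed
      show ?thesis using f(1) 1 2 by (auto simp: good_def)
    next
      case False
      then have "good h u 0" using poly_idealD(2)[OF I] by (auto simp: good_def in_keys_iff)
      then show ?thesis ..
    qed
    then show "h \<in> ?Z" using initial_forms_polys[OF IV, of lt] f by blast
  qed
  ultimately have "init_ideal V lt I \<subseteq> ?Z" unfolding init_ideal_def by (rule ideal_gen_least)
  then have "\<exists>f. good h u f" using h by blast
  then show ?thesis by (auto simp: good_def)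
qed

text \<open>Refining \<open>lt\<close> by \<open>tb\<close> means passing to the initial form first and then to its \<open>tb\<close>-leading exponent.
The inclusion from left to right needs \<open>init_ideal_classes\<close>, as the elements of the
initial ideal are not all initial forms.\<close>

lemma leads_init_ideal:
  assumes "weight_order lt" and I: "poly_ideal V I"
  shows "leads tb (init_ideal V lt I) = leads (refine tb lt) I"
proof
  interpret w: weight_order lt by fact
  show "leads (refine tb lt) I \<subseteq> leads tb (init_ideal V lt I)"
    using is_lead_initial_form[OF assms(1)] initial_form_in_init_ideal by (fastforce simp: leads_def)
  show "leads tb (init_ideal V lt I) \<subseteq> leads (refine tb lt) I"
  proof
    fix m assume "m \<in> leads tb (init_ideal V lt I)"
    then obtain h where h: "h \<in> init_ideal V lt I" "m \<in> supp h" "\<And>v. v \<in> supp h \<Longrightarrow> v \<noteq> m \<Longrightarrow> tb m v"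
      by (auto simp: leads_def is_lead_def)
    obtain f where f: "f \<in> I" "\<And>v. v \<in> supp f \<Longrightarrow> \<not> lt v m"
        "\<And>v. \<not> lt m v \<Longrightarrow> \<not> lt v m \<Longrightarrow> cf f v = cf h v"
      using init_ideal_classes[OF assms h(1), of m] by blast
    have "is_lead (refine tb lt) f m"
      unfolding is_lead_def refine_def
      using f(2,3) h(2,3) w.lt_irrefl by (metis in_keys_iff)
    then show "m \<in> leads (refine tb lt) I" using f(1) by (auto simp: leads_def)
  qed
qed

text \<open>Let \<open>Y\<close> be generated by the common initial forms of the elements of \<open>G\<close>. It is contained in both initial
ideals, and its leading exponents comprise those of the first one, so \<open>Y\<close> is the first initial ideal. The
leading exponents of \<open>I\<close> for the second order then comprise those for the first order. There are no
further ones: an element of \<open>I\<close> reduced with respect to the second order that belongs to such an extra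
exponent would have no exponent among the leading ones of the first order.\<close>

lemma init_ideal_eqI:
  assumes tb: "monomial_order V tb" and w1: "weight_order lt1" and w2: "weight_order lt2"
    and I: "poly_ideal V I" "graded I" and G: "G \<subseteq> I" "\<And>g. g \<in> G \<Longrightarrow> homogeneous g"
    and cover: "\<And>m. m \<in> leads (refine tb lt1) I \<Longrightarrow>
      \<exists>g\<in>G. \<exists>b. \<exists>s\<in>exps V. is_lead (refine tb lt1) g b \<and> m = s + b"
    and eq: "\<And>g. g \<in> G \<Longrightarrow> initial_form lt1 g = initial_form lt2 g"
  shows "init_ideal V lt1 I = init_ideal V lt2 I"
proof -
  interpret t: monomial_order V tb by fact
  interpret o1: monomial_order V "refine tb lt1" by (rule monomial_order_refine[OF tb w1])
  interpret o2: monomial_order V "refine tb lt2" by (rule monomial_order_refine[OF tb w2])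
  have IV: "I \<subseteq> polys V" using I by (simp add: poly_ideal_def)
  define Y where "Y = ideal_gen V (initial_form lt1 ` G)"
  have GV: "initial_form lt1 ` G \<subseteq> polys V" using G IV by (intro initial_forms_polys) auto
  have Y: "poly_ideal V Y" unfolding Y_def by (rule poly_ideal_ideal_gen[OF GV])
  have hom: "homogeneous (initial_form lt1 g)" if "g \<in> G" for g
    using G(2)[OF that] by (auto simp: homogeneous_def supp_initial_form)
  have grY: "graded Y" unfolding Y_def using hom by (intro ideal_gen_homogeneous_graded[OF GV]) auto
  have Y1: "Y \<subseteq> init_ideal V lt1 I" unfolding Y_def
    using G(1) initial_form_in_init_ideal[of _ I lt1 V] by (intro ideal_gen_least poly_ideal_init_ideal IV) auto
  have Y2: "Y \<subseteq> init_ideal V lt2 I" unfolding Y_def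
    using G(1) eq initial_form_in_init_ideal[of _ I lt2 V] by (intro ideal_gen_least poly_ideal_init_ideal IV) auto
  have LY: "leads (refine tb lt1) I \<subseteq> leads tb Y"
  proof
    fix m assume "m \<in> leads (refine tb lt1) I"
    then obtain g b s where g: "g \<in> G" "s \<in> exps V" "is_lead (refine tb lt1) g b" "m = s + b"
      using cover by blast
    have "b \<in> leads tb Y" using is_lead_initial_form[OF w1 g(3)] g(1) ideal_gen_subset[of "initial_form lt1 ` G" V]
      by (auto simp: leads_def Y_def)
    then show "m \<in> leads tb Y" using t.leads_up[OF Y _ g(2)] g(4) by simp
  qed
  have e1: "init_ideal V lt1 I = Y"
    using LY leads_init_ideal[OF w1 I(1), of tb]
    by (intro t.ideal_eq_if_leads poly_ideal_init_ideal IV Y grY Y1) auto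
  then have sub: "init_ideal V lt1 I \<subseteq> init_ideal V lt2 I" using Y2 by simp
  have L12: "leads (refine tb lt1) I \<subseteq> leads (refine tb lt2) I"
    using sub leads_init_ideal[OF w1 I(1), of tb] leads_init_ideal[OF w2 I(1), of tb]
    unfolding leads_def by blast
  \<comment> \<open>the reduced element for an extra exponent \<open>m\<close> has no exponent that leads for the first order\<close>
  have L21: "leads (refine tb lt2) I \<subseteq> leads (refine tb lt1) I"
  proof (rule subsetI, rule ccontr)
    fix m assume m: "m \<in> leads (refine tb lt2) I" "m \<notin> leads (refine tb lt1) I"
    obtain g where g: "g \<in> I" "supp g \<inter> leads (refine tb lt2) I = {m}"
      using o2.reduced_element[OF I m(1)] by blast
    then have "supp g \<inter> leads (refine tb lt1) I = {}" using m L12 g(2) by (auto dest: subsetD[OF L12])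
    then have "g = 0" using o1.no_leads_zero[OF IV g(1)] by simp
    then show False using g by simp
  qed
  have "init_ideal V lt2 I = Y"
    using LY L21 leads_init_ideal[OF w2 I(1), of tb]
    by (intro t.ideal_eq_if_leads poly_ideal_init_ideal IV Y grY Y2) auto
  with e1 show ?thesis by simp
qed

section \<open>Finite reduced bases\<close>

lemma exps_lookup_zero: "u \<in> exps V \<Longrightarrow> x \<notin> V \<Longrightarrow> cf u x = 0"
  by (auto simp: exps_def in_keys_iff)

lemma strict_mono_subseq_pointwise:
  fixes f :: "nat \<Rightarrow> 'x \<Rightarrow> nat"
  assumes "finite V"
  shows "\<exists>r :: nat \<Rightarrow> nat. strict_mono r \<and> (\<forall>x\<in>V. mono (\<lambda>i. f (r i) x))"
  using assms
proof (induction V)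
  case empty
  show ?case by (intro exI[of _ id]) (simp add: strict_mono_def)
next
  case (insert x V)
  then obtain r :: "nat \<Rightarrow> nat" where r: "strict_mono r" "\<And>x. x \<in> V \<Longrightarrow> mono (\<lambda>i. f (r i) x)" by blast
  obtain g where g: "strict_mono g" "monoseq (\<lambda>i. f (r (g i)) x)"
    using seq_monosub[of "\<lambda>i. f (r i) x"] by auto
  have "\<exists>N. mono (\<lambda>i. f (r (g (i + N))) x)"
  proof (cases "mono (\<lambda>i. f (r (g i)) x)")
    case True
    then show ?thesis by (intro exI[of _ 0]) simp
  next
    case False
    then have dec: "f (r (g j)) x \<le> f (r (g i)) x" if "i \<le> j" for i j
      using g(2) that unfolding monoseq_def mono_def by blast
    obtain N where N: "\<And>i. f (r (g N)) x \<le> f (r (g i)) x"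
      using ex_has_least_nat[of "\<lambda>_. True" "0::nat" "\<lambda>i. f (r (g i)) x"] by auto
    have "f (r (g (i + N))) x = f (r (g N)) x" for i using dec[of N "i + N"] N[of "i + N"] by simp
    then show ?thesis by (intro exI[of _ N]) (simp add: mono_def)
  qed
  then obtain N where N: "mono (\<lambda>i. f (r (g (i + N))) x)" ..
  have "strict_mono (\<lambda>i. r (g (i + N)))"
    using r(1) g(1) by (simp add: strict_mono_def)
  moreover have "mono (\<lambda>i. f (r (g (i + N))) y)" if "y \<in> V" for y
  proof (rule monoI)
    fix i j :: nat assume "i \<le> j"
    then have "g (i + N) \<le> g (j + N)" using g(1) by (simp add: strict_mono_less_eq)
    then show "f (r (g (i + N))) y \<le> f (r (g (j + N))) y" using r(2)[OF that] by (simp add: mono_def)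
  qed
  ultimately show ?case using N by (intro exI[of _ "\<lambda>i. r (g (i + N))"]) auto
qed

text \<open>\<open>B\<close> consists of the minimal elements of \<open>L\<close> for divisibility. An infinite set of them would contain
a sequence that is monotone in every coordinate, hence two comparable elements.\<close>

lemma Dickson:
  fixes V :: "'x set"
  assumes V: "finite V" and L: "L \<subseteq> exps V"
  shows "\<exists>B\<subseteq>L. finite B \<and> (\<forall>m\<in>L. \<exists>b\<in>B. \<exists>s\<in>exps V. m = s + b)"
proof -
  define le where "le = (\<lambda>(b :: 'x \<Rightarrow>\<^sub>0 nat) m. \<forall>x\<in>V. cf b x \<le> cf m x)"
  have eqI: "b = m" if "b \<in> L" "m \<in> L" "\<forall>x\<in>V. cf b x = cf m x" for b m
  proof (rule poly_mapping_eqI)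
    fix x show "cf b x = cf m x"
      using that subsetD[OF L, THEN exps_lookup_zero, of _ x] by (cases "x \<in> V") auto
  qed
  define B where "B = {b \<in> L. \<forall>b'\<in>L. le b' b \<longrightarrow> b' = b}"
  have "finite B"
  proof (rule ccontr)
    assume "infinite B"
    then obtain f :: "nat \<Rightarrow> _" where f: "inj f" "range f \<subseteq> B" using infinite_countable_subset by blast
    obtain r :: "nat \<Rightarrow> nat" where r: "strict_mono r" "\<And>x. x \<in> V \<Longrightarrow> mono (\<lambda>i. cf (f (r i)) x)"
      using strict_mono_subseq_pointwise[OF V, of "\<lambda>i. cf (f i)"] by blast
    have "le (f (r 0)) (f (r 1))" unfolding le_def using r(2) by (auto simp: mono_def)
    then have "f (r 0) = f (r 1)" using f(2) unfolding B_def by blast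
    then have "r 0 = r 1" using f(1) by (simp add: inj_eq)
    then show False using r(1) strict_mono_eq[OF r(1), of 0 1] by simp
  qed
  moreover have "\<exists>b\<in>B. \<exists>s\<in>exps V. m = s + b" if m: "m \<in> L" for m
  proof -
    obtain b where b: "b \<in> L" "le b m" and least: "\<And>y. y \<in> L \<Longrightarrow> le y m \<Longrightarrow> (\<Sum>x\<in>V. cf b x) \<le> (\<Sum>x\<in>V. cf y x)"
      using ex_has_least_nat[of "\<lambda>b. b \<in> L \<and> le b m" m "\<lambda>b. \<Sum>x\<in>V. cf b x"] m by (auto simp: le_def)
    have "y = b" if y: "y \<in> L" "le y b" for y
    proof (rule eqI[OF y(1) b(1)], rule ccontr)
      assume "\<not> (\<forall>x\<in>V. cf y x = cf b x)"
      then have "(\<Sum>x\<in>V. cf y x) < (\<Sum>x\<in>V. cf b x)"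
        using y(2) V by (intro sum_strict_mono_ex1) (auto simp: le_def order_less_le)
      moreover have "le y m" using y(2) b(2) unfolding le_def by (meson order_trans)
      ultimately show False using least[OF y(1)] by simp
    qed
    then have "b \<in> B" using b by (simp add: B_def)
    moreover have "m - b \<in> exps V"
      using exps_lookup_zero[OF subsetD[OF L m]] by (force simp: exps_def in_keys_iff lookup_minus)
    moreover have "m = (m - b) + b"
    proof (rule poly_mapping_eqI)
      fix x
      have "cf b x \<le> cf m x"
        using b m subsetD[OF L, THEN exps_lookup_zero, of _ x] by (cases "x \<in> V") (auto simp: le_def)
      then show "cf m x = cf (m - b + b) x" by (simp add: lookup_add lookup_minus)
    qed
    ultimately show ?thesis by blast
  qed
  ultimately show ?thesis by (intro exI[of _ B]) (auto simp: B_def)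
qed

text \<open>The lexicographic order for some enumeration of \<open>V\<close>.\<close>

lemma ex_monomial_order:
  fixes V :: "'x set"
  assumes V: "finite V" shows "\<exists>tb. monomial_order V tb"
proof -
  obtain e where e: "bij_betw e {..<card V} V" using V by (metis ex_bij_betw_nat_finite atLeast0LessThan)
  define tb where "tb = (\<lambda>(u :: 'x \<Rightarrow>\<^sub>0 nat) v. \<exists>i<card V. cf u (e i) < cf v (e i) \<and> (\<forall>j<i. cf u (e j) = cf v (e j)))"
  have "monomial_order V tb"
  proof
    show "finite V" by fact
    show "\<not> tb u u" for u by (simp add: tb_def)
    show "tb u w" if uv: "tb u v" and vw: "tb v w" for u v w
    proof -
      obtain i where i: "i < card V" "cf u (e i) < cf v (e i)" "\<And>l. l < i \<Longrightarrow> cf u (e l) = cf v (e l)"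
        using uv by (auto simp: tb_def)
      obtain j where j: "j < card V" "cf v (e j) < cf w (e j)" "\<And>l. l < j \<Longrightarrow> cf v (e l) = cf w (e l)"
        using vw by (auto simp: tb_def)
      have "cf u (e (min i j)) < cf w (e (min i j))"
        using i(2) i(3)[of j] j(2) j(3)[of i] by (cases i j rule: linorder_cases) auto
      then show ?thesis unfolding tb_def using i j by (intro exI[of _ "min i j"]) auto
    qed
    show "tb u v \<or> tb v u" if u: "u \<in> exps V" and v: "v \<in> exps V" and "u \<noteq> v" for u v
    proof -
      obtain x where x: "cf u x \<noteq> cf v x" using \<open>u \<noteq> v\<close> by (auto simp: poly_mapping_eq_iff fun_eq_iff)
      then have "x \<in> V" using exps_lookup_zero[OF u, of x] exps_lookup_zero[OF v, of x] by (cases "x \<in> V") simp_all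
      then have "x \<in> e ` {..<card V}" using e by (simp add: bij_betw_def)
      then obtain i where i: "i < card V" "e i = x" by auto
      define P where "P = (\<lambda>i. cf u (e i) \<noteq> cf v (e i))"
      have P: "P (Least P)" and less: "\<And>j. j < Least P \<Longrightarrow> \<not> P j"
        using x i LeastI[of P i] not_less_Least by (auto simp: P_def)
      have "Least P \<le> i" using x i by (intro Least_le) (simp add: P_def)
      then have "Least P < card V" using i by simp
      moreover have "cf u (e (Least P)) < cf v (e (Least P)) \<or> cf v (e (Least P)) < cf u (e (Least P))"
        using P unfolding P_def by linarith
      moreover have "\<forall>j<Least P. cf u (e j) = cf v (e j)" using less unfolding P_def by blast
      ultimately show ?thesis using \<open>Least P < card V\<close> unfolding tb_def by metis
    qed
    show "tb (s + u) (s + v)" if "tb u v" for s u v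
      using that by (simp add: tb_def lookup_add)
  qed
  then show ?thesis by blast
qed

lemma (in monomial_order) finite_reduced_basis:
  assumes I: "poly_ideal V I" "graded I"
  shows "\<exists>G\<subseteq>I. finite G \<and> (\<forall>g\<in>G. homogeneous g \<and> (\<exists>m. supp g \<inter> leads ls I = {m})) \<and>
    (\<forall>m\<in>leads ls I. \<exists>g\<in>G. \<exists>b. \<exists>s\<in>exps V. is_lead ls g b \<and> m = s + b)"
proof -
  have IV: "I \<subseteq> polys V" using I by (simp add: poly_ideal_def)
  obtain B where B: "B \<subseteq> leads ls I" "finite B" "\<And>m. m \<in> leads ls I \<Longrightarrow> \<exists>b\<in>B. \<exists>s\<in>exps V. m = s + b"
    using Dickson[OF finite_vars leads_exps[OF IV]] by blast
  have "\<forall>b\<in>B. \<exists>g. g \<in> I \<and> homogeneous g \<and> supp g \<inter> leads ls I = {b}"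
    using reduced_element[OF I] B(1) by blast
  then obtain g where g: "\<And>b. b \<in> B \<Longrightarrow> g b \<in> I \<and> homogeneous (g b) \<and> supp (g b) \<inter> leads ls I = {b}"
    by metis
  show ?thesis
  proof (intro exI[of _ "g ` B"] conjI ballI)
    show "g ` B \<subseteq> I" "finite (g ` B)" using g B by auto
    fix h assume "h \<in> g ` B"
    then show "homogeneous h" "\<exists>m. supp h \<inter> leads ls I = {m}" using g by auto
  next
    fix m assume "m \<in> leads ls I"
    then obtain b s where bs: "b \<in> B" "s \<in> exps V" "m = s + b" using B(3) by blast
    moreover have "is_lead ls (g b) b" using g[OF bs(1)] by (intro lead_of_reduced[OF IV]) auto
    ultimately show "\<exists>g\<in>g ` B. \<exists>b. \<exists>s\<in>exps V. is_lead ls g b \<and> m = s + b" by blast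
  qed
qed

section \<open>Weights with the same initial ideal\<close>

definition weight :: "'x set \<Rightarrow> ('x \<Rightarrow>\<^sub>0 real) \<Rightarrow> ('x \<Rightarrow>\<^sub>0 nat) \<Rightarrow> real" where
  "weight V w u = (\<Sum>x\<in>V. cf w x * real (cf u x))"

definition weight_less :: "'x set \<Rightarrow> ('x \<Rightarrow>\<^sub>0 real) \<Rightarrow> ('x \<Rightarrow>\<^sub>0 nat) \<Rightarrow> ('x \<Rightarrow>\<^sub>0 nat) \<Rightarrow> bool" where
  "weight_less V w u v \<longleftrightarrow> weight V w u < weight V w v"

lemma weight_add: "weight V w (u + v) = weight V w u + weight V w v"
  by (simp add: weight_def lookup_add sum.distrib algebra_simps)

lemma weight_order_weight_less: "weight_order (weight_less V w)"
  by unfold_locales (auto simp: weight_less_def weight_add)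

lemma initial_form_eq_iff_supp:
  "initial_form lt1 g = initial_form lt2 g \<longleftrightarrow> supp (initial_form lt1 g) = supp (initial_form lt2 g)"
proof
  assume eq: "supp (initial_form lt1 g) = supp (initial_form lt2 g)"
  show "initial_form lt1 g = initial_form lt2 g"
  proof (rule poly_mapping_eqI)
    fix u show "cf (initial_form lt1 g) u = cf (initial_form lt2 g) u"
      using eq cf_initial_form[of u lt1 g] cf_initial_form[of u lt2 g]
      by (cases "u \<in> supp (initial_form lt1 g)") (auto simp: in_keys_iff)
  qed
qed simp

lemma initial_form_eq_iff_weight:
  assumes "initial_form (weight_less V w0) g \<noteq> 0"
  defines "A \<equiv> supp (initial_form (weight_less V w0) g)"
  shows "initial_form (weight_less V w) g = initial_form (weight_less V w0) g \<longleftrightarrow>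
    (\<forall>u\<in>A. \<forall>v\<in>A. weight V w u = weight V w v) \<and> (\<forall>u\<in>A. \<forall>v\<in>supp g - A. weight V w u < weight V w v)"
proof
  assume "initial_form (weight_less V w) g = initial_form (weight_less V w0) g"
  then have "A = supp (initial_form (weight_less V w) g)" by (simp add: A_def)
  then have A: "A = {u \<in> supp g. \<forall>v\<in>supp g. weight V w u \<le> weight V w v}"
    by (simp add: supp_initial_form weight_less_def not_less)
  show "(\<forall>u\<in>A. \<forall>v\<in>A. weight V w u = weight V w v) \<and> (\<forall>u\<in>A. \<forall>v\<in>supp g - A. weight V w u < weight V w v)"
      proof (intro conjI ballI)
    fix u v assume "u \<in> A" "v \<in> A"
    then show "weight V w u = weight V w v" unfolding A by (simp add: order_antisym)
  next
    fix u v assume "u \<in> A" "v \<in> supp g - A"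
    then obtain z where "z \<in> supp g" "weight V w z < weight V w v" "weight V w u \<le> weight V w z" unfolding A by (auto simp: not_le)
    then show "weight V w u < weight V w v" by linarith
  qed
next
  assume *: "(\<forall>u\<in>A. \<forall>v\<in>A. weight V w u = weight V w v) \<and> (\<forall>u\<in>A. \<forall>v\<in>supp g - A. weight V w u < weight V w v)"
  have sub: "A \<subseteq> supp g" by (auto simp: A_def supp_initial_form)
  obtain a where a: "a \<in> A" using assms(1) unfolding A_def by (metis all_not_in_conv keys_eq_empty)
  have "supp (initial_form (weight_less V w) g) = A"
  proof (intro Set.set_eqI iffI)
    fix u assume "u \<in> supp (initial_form (weight_less V w) g)"
    then have "u \<in> supp g" "\<not> weight V w a < weight V w u" using a sub by (auto simp: supp_initial_form weight_less_def)
    then show "u \<in> A" using * a by blast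
  next
    fix u assume u: "u \<in> A"
    have "weight V w u = weight V w v \<or> weight V w u < weight V w v" if "v \<in> supp g" for v
      using * u that by (cases "v \<in> A") blast+
    then have "weight V w u \<le> weight V w v" if "v \<in> supp g" for v using that by (simp add: le_less disj_commute)
    then show "u \<in> supp (initial_form (weight_less V w) g)" using u sub by (auto simp: supp_initial_form weight_less_def not_less)
  qed
  then show "initial_form (weight_less V w) g = initial_form (weight_less V w0) g"
    by (simp add: initial_form_eq_iff_supp A_def)
qed

lemma initial_form_nonzero:
  assumes tb: "monomial_order V tb" and w: "weight_order lt" and "g \<in> polys V" "g \<noteq> 0"
  shows "initial_form lt g \<noteq> 0"
proof -
  interpret o: monomial_order V "refine tb lt" by (rule monomial_order_refine[OF tb w])
  obtain m where "is_lead (refine tb lt) g m" using o.ex_lead assms by blast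
  then have "m \<in> supp (initial_form lt g)" using is_lead_initial_form[OF w] by (auto simp: is_lead_def)
  then show ?thesis by auto
qed

text \<open>Let \<open>G\<close> be a finite reduced basis for the order of \<open>w0\<close> refined by \<open>tb\<close>. If \<open>w\<close> and \<open>w0\<close> have the same
initial ideal, they have the same leading exponents of \<open>I\<close>. The support of \<open>g \<in> G\<close> contains only one of
them, so both initial forms of \<open>g\<close> contain it with the same coefficient. Their difference is
in the initial ideal without containing any leading exponent, and vanishes. The converse is
\<open>init_ideal_eqI\<close>. Equality of the initial forms for \<open>w\<close> and \<open>w0\<close> is a system of equations \<open>E\<close> and strict
inequalities \<open>N\<close> in \<open>w\<close>.\<close>

lemma same_init_ideal_conditions:
  assumes V: "finite V" and I: "poly_ideal V I" "graded I"
  shows "\<exists>E N. finite E \<and> finite N \<and> (\<forall>w. init_ideal V (weight_less V w) I = init_ideal V (weight_less V w0) I \<longleftrightarrow>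
    (\<forall>(u, v)\<in>E. weight V w u = weight V w v) \<and> (\<forall>(u, v)\<in>N. weight V w u < weight V w v))"
proof -
  obtain tb where tb: "monomial_order V tb" using ex_monomial_order[OF V] ..
  note W = weight_order_weight_less
  interpret t: monomial_order V tb by fact
  interpret o: monomial_order V "refine tb (weight_less V w0)" by (rule monomial_order_refine[OF tb W])
  have IV: "I \<subseteq> polys V" using I by (simp add: poly_ideal_def)
  let ?L = "leads (refine tb (weight_less V w0)) I"
  from o.finite_reduced_basis[OF I] obtain G where G: "G \<subseteq> I" "finite G"
      "\<forall>g\<in>G. homogeneous g \<and> (\<exists>m. supp g \<inter> ?L = {m})"
      "\<forall>m\<in>?L. \<exists>g\<in>G. \<exists>b. \<exists>s\<in>exps V. is_lead (refine tb (weight_less V w0)) g b \<and> m = s + b"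
    by (elim exE conjE)
  define A where "A = (\<lambda>g. supp (initial_form (weight_less V w0) g))"
  define E where "E = (\<Union>g\<in>G. A g \<times> A g)"
  define N where "N = (\<Union>g\<in>G. A g \<times> (supp g - A g))"
  have fin: "finite E" "finite N" using G(2) by (auto simp: E_def N_def A_def)
  have nz: "initial_form (weight_less V w') g \<noteq> 0" if "g \<in> G" for g w'
  proof (rule initial_form_nonzero[OF tb W])
    show "g \<in> polys V" using that G(1) IV by auto
    show "g \<noteq> 0" using that G(3) by auto
  qed
  have "init_ideal V (weight_less V w) I = init_ideal V (weight_less V w0) I \<longleftrightarrow>
      (\<forall>g\<in>G. initial_form (weight_less V w) g = initial_form (weight_less V w0) g)" for w
  proof
    assume "\<forall>g\<in>G. initial_form (weight_less V w) g = initial_form (weight_less V w0) g"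
    then have "init_ideal V (weight_less V w0) I = init_ideal V (weight_less V w) I"
      using G by (intro init_ideal_eqI[OF tb W W I, of G]) auto
    then show "init_ideal V (weight_less V w) I = init_ideal V (weight_less V w0) I" ..
  next
    assume eq: "init_ideal V (weight_less V w) I = init_ideal V (weight_less V w0) I"
    note LL = leads_init_ideal[OF W I(1), where tb = tb]
    show "\<forall>g\<in>G. initial_form (weight_less V w) g = initial_form (weight_less V w0) g"
    proof
      fix g assume g: "g \<in> G"
      obtain m where m: "supp g \<inter> ?L = {m}" using G(3) g by blast
      have *: "m \<in> supp (initial_form (weight_less V w') g)" if eq': "init_ideal V (weight_less V w') I = init_ideal V (weight_less V w0) I" for w'
      proof -
        have mem: "initial_form (weight_less V w') g \<in> init_ideal V (weight_less V w') I"
          using g G(1) initial_form_in_init_ideal by blast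
        obtain b where b: "is_lead tb (initial_form (weight_less V w') g) b"
          using t.ex_lead[OF poly_idealD(1)[OF poly_ideal_init_ideal[OF IV] mem] nz[OF g]] by blast
        then have "b \<in> leads tb (init_ideal V (weight_less V w0) I)" using mem eq' by (auto simp: leads_def)
        then have "b \<in> ?L" using LL by simp
        moreover have "b \<in> supp (initial_form (weight_less V w') g)" using b by (simp add: is_lead_def)
        ultimately show ?thesis using m by (auto simp: supp_initial_form)
      qed
      let ?h = "initial_form (weight_less V w) g - initial_form (weight_less V w0) g"
      have "?h \<in> init_ideal V (weight_less V w0) I"
        using g G(1) initial_form_in_init_ideal[of g I "weight_less V w" V] initial_form_in_init_ideal[of g I "weight_less V w0" V] eq
        by (intro poly_ideal_diff[OF poly_ideal_init_ideal[OF IV]]) auto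
      moreover have "supp ?h \<inter> leads tb (init_ideal V (weight_less V w0) I) = {}"
      proof -
        have "supp ?h \<subseteq> supp g"
          using keys_diff[of "initial_form (weight_less V w) g" "initial_form (weight_less V w0) g"]
          by (auto simp: supp_initial_form)
        moreover have "m \<notin> supp ?h"
          using cf_initial_form[OF *[OF eq]] cf_initial_form[OF *[OF refl]]
          by (simp add: in_keys_iff lookup_minus)
        ultimately have "x \<notin> ?L" if "x \<in> supp ?h" for x using m that by (cases "x = m") blast+
        then have "supp ?h \<inter> ?L = {}" by blast
        then show ?thesis by (simp only: LL)
      qed
      ultimately have "?h = 0"
        using poly_ideal_init_ideal[OF IV] by (intro t.no_leads_zero) (auto simp: poly_ideal_def)
      then show "initial_form (weight_less V w) g = initial_form (weight_less V w0) g" by simp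
    qed
  qed
  also have "(\<forall>g\<in>G. initial_form (weight_less V w) g = initial_form (weight_less V w0) g) \<longleftrightarrow>
      (\<forall>g\<in>G. (\<forall>u\<in>A g. \<forall>v\<in>A g. weight V w u = weight V w v) \<and>
        (\<forall>u\<in>A g. \<forall>v\<in>supp g - A g. weight V w u < weight V w v))" for w
    unfolding A_def using initial_form_eq_iff_weight[OF nz] by (rule ball_cong[OF refl])
  also have "(\<forall>g\<in>G. (\<forall>u\<in>A g. \<forall>v\<in>A g. weight V w u = weight V w v) \<and>
        (\<forall>u\<in>A g. \<forall>v\<in>supp g - A g. weight V w u < weight V w v)) \<longleftrightarrow>
      (\<forall>(u, v)\<in>E. weight V w u = weight V w v) \<and> (\<forall>(u, v)\<in>N. weight V w u < weight V w v)" for w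
    unfolding E_def N_def by (auto simp only: ball_UN ball_simps split_paired_Ball_Sigma prod.case ball_conj_distrib)
  finally show ?thesis using fin by blast
qed

section \<open>Relatively open cones\<close>

text \<open>\<open>K\<close> is open in \<open>L\<close> and nonempty, so it spans \<open>L\<close>. On the closure all \<open>\<phi> \<in> \<Phi>\<close> are
nonnegative. A point \<open>x\<close> of the relative interior can be moved a little away from \<open>x0 \<in> K\<close>
without leaving the closure; if \<open>\<phi> x = 0\<close>, then \<open>\<phi>\<close> would become negative there.\<close>

lemma rel_interior_closure_open_cone:
  fixes L :: "'a::real_normed_vector set" and \<Phi> :: "('a \<Rightarrow> real) set"
  assumes L: "Real_Vector_Spaces.subspace L" "closed L" and \<Phi>: "finite \<Phi>" "\<And>\<phi>. \<phi> \<in> \<Phi> \<Longrightarrow> bounded_linear \<phi>"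
  defines "K \<equiv> {x \<in> L. \<forall>\<phi>\<in>\<Phi>. 0 < \<phi> x}"
  assumes ne: "x0 \<in> K"
  shows "rel_interior (closure K) = K"
proof -
  have x0: "x0 \<in> L" "\<And>\<phi>. \<phi> \<in> \<Phi> \<Longrightarrow> 0 < \<phi> x0" using ne by (auto simp: K_def)
  have cL: "closure K \<subseteq> L" using L(2) by (intro closure_minimal) (auto simp: K_def)
  have weak: "0 \<le> \<phi> x" if "\<phi> \<in> \<Phi>" "x \<in> closure K" for \<phi> x
  proof -
    have "closed {x. 0 \<le> \<phi> x}"
      using linear_continuous_on[OF \<Phi>(2)[OF that(1)], of UNIV] by (intro closed_Collect_le) (auto intro: continuous_intros)
    then have "closure K \<subseteq> {x. 0 \<le> \<phi> x}" using that(1) by (intro closure_minimal) (auto simp: K_def intro: less_imp_le)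
    then show ?thesis using that by auto
  qed
  have line: "((\<lambda>t. x + t *\<^sub>R y) \<longlongrightarrow> x) (at_right (0::real))" for x y :: 'a
    by (rule tendsto_eq_intros refl | simp)+
  have hull: "affine hull (closure K) = L"
  proof
    show "affine hull closure K \<subseteq> L"
      using cL L(1) by (intro hull_minimal) (auto intro: subspace_imp_affine)
    show "L \<subseteq> affine hull closure K"
    proof
      fix x assume x: "x \<in> L"
      have "\<forall>\<^sub>F t in at_right (0::real). \<forall>\<phi>\<in>\<Phi>. 0 < \<phi> (x0 + t *\<^sub>R (x - x0))"
      proof (rule eventually_ball_finite[OF \<Phi>(1)], rule ballI)
        fix \<phi> assume \<phi>: "\<phi> \<in> \<Phi>"
        have "((\<lambda>t. \<phi> (x0 + t *\<^sub>R (x - x0))) \<longlongrightarrow> \<phi> x0) (at_right (0::real))"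
          by (rule bounded_linear.tendsto[OF \<Phi>(2)[OF \<phi>] line])
        then show "\<forall>\<^sub>F t in at_right 0. 0 < \<phi> (x0 + t *\<^sub>R (x - x0))"
          using x0(2)[OF \<phi>] by (rule order_tendstoD)
      qed
      moreover have "\<forall>\<^sub>F t in at_right (0::real). 0 < t" by (simp add: eventually_at_right_less)
      ultimately have "\<forall>\<^sub>F t in at_right (0::real). 0 < t \<and> (\<forall>\<phi>\<in>\<Phi>. 0 < \<phi> (x0 + t *\<^sub>R (x - x0)))"
        by eventually_elim simp
      then obtain t :: real where t: "0 < t" "\<forall>\<phi>\<in>\<Phi>. 0 < \<phi> (x0 + t *\<^sub>R (x - x0))"
        using eventually_happens trivial_limit_at_right_real by blast
      have "x0 + t *\<^sub>R (x - x0) \<in> L" using L(1) x x0(1) by (intro subspace_add subspace_mul subspace_diff)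
      then have "x0 + t *\<^sub>R (x - x0) \<in> K" using t by (simp add: K_def)
      then have 1: "x0 + t *\<^sub>R (x - x0) \<in> affine hull closure K" "x0 \<in> affine hull closure K"
        using ne closure_subset hull_inc by (metis subsetD)+
      \<comment> \<open>an affine combination of two points of \<open>K\<close>, with one coefficient possibly negative\<close>
      have "x = (1 - 1 / t) *\<^sub>R x0 + (1 / t) *\<^sub>R (x0 + t *\<^sub>R (x - x0))"
        using t(1) by (simp add: algebra_simps)
      then show "x \<in> affine hull closure K"
        using mem_affine[OF affine_affine_hull 1(2,1), of "1 - 1 / t" "1 / t"] by simp
    qed
  qed
  show ?thesis
  proof
    have "open (\<Inter>\<phi>\<in>\<Phi>. {x. 0 < \<phi> x})"
      using \<Phi> by (intro open_INT ballI open_Collect_less linear_continuous_on) (auto intro: continuous_intros)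
    moreover have "K = L \<inter> (\<Inter>\<phi>\<in>\<Phi>. {x. 0 < \<phi> x})" by (auto simp: K_def)
    ultimately have "openin (top_of_set L) K" by (auto simp: openin_open)
    then show "K \<subseteq> rel_interior (closure K)"
      unfolding rel_interior_def hull using closure_subset by blast
    show "rel_interior (closure K) \<subseteq> K"
    proof
      fix x assume "x \<in> rel_interior (closure K)"
      then obtain T where T: "open T" "x \<in> T" "T \<inter> L \<subseteq> closure K" and x: "x \<in> closure K"
        unfolding rel_interior hull by auto
      have xL: "x \<in> L" using x cL by auto
      have "\<forall>\<^sub>F t in at_right (0::real). x + t *\<^sub>R (x - x0) \<in> T"
        using line T(1,2) by (rule topological_tendstoD)
      moreover have "\<forall>\<^sub>F t in at_right (0::real). 0 < t" by (simp add: eventually_at_right_less)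
      ultimately have "\<forall>\<^sub>F t in at_right (0::real). 0 < t \<and> x + t *\<^sub>R (x - x0) \<in> T"
        by eventually_elim simp
      then obtain t :: real where t: "0 < t" "x + t *\<^sub>R (x - x0) \<in> T"
        using eventually_happens trivial_limit_at_right_real by blast
      have "x + t *\<^sub>R (x - x0) \<in> L" using L(1) xL x0(1) by (intro subspace_add subspace_mul subspace_diff)
      then have cl: "x + t *\<^sub>R (x - x0) \<in> closure K" using t(2) T(3) by auto
      have "0 < \<phi> x" if \<phi>: "\<phi> \<in> \<Phi>" for \<phi>
      proof (rule ccontr)
        assume "\<not> 0 < \<phi> x"
        then have 0: "\<phi> x = 0" using weak[OF \<phi> x] by simp
        interpret bounded_linear \<phi> by (rule \<Phi>(2)[OF \<phi>])
        \<comment> \<open>moving away from \<open>x0\<close> would violate the inequality \<open>\<phi>\<close>, which holds on the closure\<close>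
        have "\<phi> (x + t *\<^sub>R (x - x0)) = - t * \<phi> x0" by (simp add: add scale diff 0)
        moreover have "0 < t * \<phi> x0" using t(1) x0(2)[OF \<phi>] by simp
        ultimately show False using weak[OF \<phi> cl] by simp
      qed
      then show "x \<in> K" using xL by (simp add: K_def)
    qed
  qed
qed

lemma lookup_scaleR_poly_mapping: "cf (r *\<^sub>R w) x = r *\<^sub>R cf w x"
proof -
  have "finite {x. r *\<^sub>R cf w x \<noteq> 0}" by (rule finite_subset[OF _ finite_keys[of w]]) (auto simp: in_keys_iff)
  then show ?thesis by (simp add: scaleR_poly_mapping_def)
qed

lemma bounded_linear_lookup: "bounded_linear (\<lambda>w :: 'x \<Rightarrow>\<^sub>0 real. cf w x)"
proof (rule bounded_linear_intro[where K = 1])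
  fix w :: "'x \<Rightarrow>\<^sub>0 real"
  have "norm w = (\<Sum>n\<in>supp w. \<bar>cf w n\<bar>)"
    by (simp add: norm_poly_mapping_def dist_poly_mapping_def)
  moreover have "\<bar>cf w x\<bar> \<le> (\<Sum>n\<in>supp w. \<bar>cf w n\<bar>)"
    by (cases "x \<in> supp w") (auto intro: member_le_sum sum_nonneg simp: in_keys_iff)
  ultimately show "norm (cf w x) \<le> norm w * 1" by simp
qed (simp_all add: lookup_add lookup_scaleR_poly_mapping)

lemma bounded_linear_weight: "bounded_linear (\<lambda>w. weight V w u)"
  unfolding weight_def
  by (intro bounded_linear_sum bounded_linear_mult_const bounded_linear_lookup)

lemma continuous_on_weight: "continuous_on S (\<lambda>w. weight V w u)"
  by (rule linear_continuous_on[OF bounded_linear_weight])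

text \<open>If the initial ideal of \<open>w\<close> contains a monomial, then the monomial is the initial form of some \<open>f\<close> in
\<open>I\<close>. The finitely many strict inequalities expressing this persist near \<open>w\<close>, in particular at a point of \<open>K\<close>.\<close>

lemma no_monomial_closure:
  assumes I: "poly_ideal V I" and w: "w \<in> closure K"
    and K: "\<And>w'. w' \<in> K \<Longrightarrow> init_ideal V (weight_less V w') I = X" and X: "mterm u 1 \<notin> X"
  shows "mterm u 1 \<notin> init_ideal V (weight_less V w) I"
proof
  assume "mterm u 1 \<in> init_ideal V (weight_less V w) I"
  then obtain f where f: "f \<in> I" "\<And>v. v \<in> supp f \<Longrightarrow> \<not> weight V w v < weight V w u"
      "\<And>v. weight V w v = weight V w u \<Longrightarrow> cf f v = cf (mterm u 1) v"
    using init_ideal_classes[OF weight_order_weight_less I, of "mterm u 1" V w u] unfolding weight_less_def by (metis less_irrefl)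
  have fu: "cf f u = 1" using f(3)[of u] by simp
  have strict: "weight V w u < weight V w v" if "v \<in> supp f" "v \<noteq> u" for v
    using f(2)[OF that(1)] f(3)[of v] that by (auto simp: in_keys_iff lookup_single less_le)
  let ?U = "\<Inter>v\<in>supp f - {u}. {w. weight V w u < weight V w v}"
  have "open ?U" by (intro open_INT ballI open_Collect_less continuous_on_weight) simp
  moreover have "w \<in> ?U" using strict by auto
  ultimately have "?U \<inter> K \<noteq> {}" using w open_Int_closure_eq_empty[of ?U K] by blast
  then obtain w' where w': "w' \<in> K" "w' \<in> ?U" by blast
  have strict': "weight V w' u < weight V w' v" if "v \<in> supp f" "v \<noteq> u" for v using w'(2) that by blast
  have u: "u \<in> supp f" using fu by (simp add: in_keys_iff)
  have "supp (initial_form (weight_less V w') f) = {u}"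
  proof (rule subset_antisym)
    show "supp (initial_form (weight_less V w') f) \<subseteq> {u}"
      using u strict' by (auto simp: supp_initial_form weight_less_def)
    show "{u} \<subseteq> supp (initial_form (weight_less V w') f)"
      using u strict' by (force simp: supp_initial_form weight_less_def)
  qed
  moreover from this have "cf (initial_form (weight_less V w') f) u = 1"
    using cf_initial_form[of u "weight_less V w'" f] fu by simp
  ultimately have "initial_form (weight_less V w') f = mterm u 1"
    by (intro poly_mapping_eqI) (auto simp: lookup_single when_def in_keys_iff set_eq_iff)
  then have "mterm u 1 \<in> init_ideal V (weight_less V w') I" using initial_form_in_init_ideal[OF f(1)] by metis
  then show False using K[OF w'(1)] X by simp
qed

lemma same_init_ideal_rel_interior:
  fixes V :: "'x set"
  assumes V: "finite V" and I: "poly_ideal V I" "graded I"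
  defines "K \<equiv> \<lambda>w0. {w. supp w \<subseteq> V \<and> init_ideal V (weight_less V w) I = init_ideal V (weight_less V w0) I}"
  assumes w0: "supp w0 \<subseteq> V"
  shows "rel_interior (closure (K w0)) = K w0"
proof -
  obtain E N where EN: "finite E" "finite N"
    "\<And>w. init_ideal V (weight_less V w) I = init_ideal V (weight_less V w0) I \<longleftrightarrow>
      (\<forall>(u, v)\<in>E. weight V w u = weight V w v) \<and> (\<forall>(u, v)\<in>N. weight V w u < weight V w v)"
    using same_init_ideal_conditions[OF V I] by metis
  define L where "L = {w. supp w \<subseteq> V \<and> (\<forall>(u, v)\<in>E. weight V w u = weight V w v)}"
  define \<Phi> where "\<Phi> = (\<lambda>(u, v) w. weight V w v - weight V w u) ` N"
  have L: "L = (\<Inter>x\<in>- V. {w. cf w x = 0}) \<inter> (\<Inter>(u, v)\<in>E. {w. weight V w u - weight V w v = 0})"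
    by (force simp: L_def in_keys_iff)
  have ker: "Real_Vector_Spaces.subspace {w. \<phi> w = 0} \<and> closed {w. \<phi> w = 0}" if "bounded_linear \<phi>" for \<phi> :: "('x \<Rightarrow>\<^sub>0 real) \<Rightarrow> real"
    using linear_subspace_kernel[OF bounded_linear.linear[OF that]]
      linear_continuous_on[OF that, of UNIV] by (auto intro: closed_Collect_eq continuous_intros)
  have bl: "bounded_linear (\<lambda>w. weight V w u - weight V w v)" for u v
    by (intro bounded_linear_sub bounded_linear_weight)
  have "Real_Vector_Spaces.subspace L" "closed L"
    unfolding L using ker[OF bl] ker[OF bounded_linear_lookup]
    by (auto intro!: subspace_inter subspace_Inter closed_Int closed_INT)
  moreover have "finite \<Phi>" "\<And>\<phi>. \<phi> \<in> \<Phi> \<Longrightarrow> bounded_linear \<phi>" using EN(2) bl by (auto simp: \<Phi>_def)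
  moreover have "K w0 = {x \<in> L. \<forall>\<phi>\<in>\<Phi>. 0 < \<phi> x}"
    unfolding K_def EN(3) L_def \<Phi>_def by auto
  moreover have "w0 \<in> K w0" using w0 by (simp add: K_def)
  ultimately show ?thesis using rel_interior_closure_open_cone[of L \<Phi> w0] by simp
qed

section \<open>The Pluecker ideal as an ideal of polynomials\<close>

lemma carrier_plucker_ring: "carrier (plucker_ring k n) = polys (plucker_index k n)"
  by (auto simp: plucker_ring_def polys_def exps_def)

lemma finite_plucker_index: "finite (plucker_index k n)"
  unfolding plucker_index_def by (rule finite_subset[of _ "Pow {..<n}"]) auto

lemma poly_ideal_times:
  assumes X: "poly_ideal V X" and p: "p \<in> polys V" and f: "f \<in> X"
  shows "p * f \<in> X"
proof -
  have "p * f = (\<Sum>u\<in>supp p. mterm u (cf p u) * f)"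
    using arg_cong[OF mpoly_eq_sum_monoms[of p], of "\<lambda>q. q * f"] by (simp add: sum_distrib_right)
  also have "\<dots> \<in> X"
    by (intro poly_ideal_sum[OF X] poly_idealD(4)[OF X f] polysD[OF p])
  finally show ?thesis .
qed

lemma plucker_ring_simps:
  "f \<otimes>\<^bsub>plucker_ring k n\<^esub> g = f * g" "f \<oplus>\<^bsub>plucker_ring k n\<^esub> g = f + g"
  "\<one>\<^bsub>plucker_ring k n\<^esub> = 1" "\<zero>\<^bsub>plucker_ring k n\<^esub> = 0"
  by (simp_all add: plucker_ring_def)

lemma ideal_plucker_ring_iff:
  "ideal X (plucker_ring k n) \<longleftrightarrow> poly_ideal (plucker_index k n) X"
proof
  let ?R = "plucker_ring k n" and ?V = "plucker_index k n"
  interpret R: cring ?R by (rule cring_plucker_ring)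
  {
    assume "ideal X ?R"
    then interpret X: ideal X ?R .
    show "poly_ideal ?V X"
      unfolding poly_ideal_def
    proof (intro conjI ballI allI)
      show "X \<subseteq> polys ?V" using X.a_subset by (simp add: carrier_plucker_ring)
      show "0 \<in> X" using X.zero_closed by (simp add: plucker_ring_simps)
      show "f + g \<in> X" if "f \<in> X" "g \<in> X" for f g
        using X.a_closed[OF that] by (simp add: plucker_ring_simps)
      show "mterm s c * f \<in> X" if "f \<in> X" "s \<in> exps ?V" for f s c
        using X.I_l_closed[OF that(1), of "mterm s c"] polys_monom[OF that(2), of c]
        by (simp add: plucker_ring_simps carrier_plucker_ring)
    qed
  next
    assume X: "poly_ideal ?V X"
    show "ideal X ?R"
    proof (rule idealI)
      show "ring ?R" by (rule R.ring_axioms)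
      have inv: "\<ominus>\<^bsub>?R\<^esub> f = - f" if "f \<in> X" for f
      proof (rule R.minus_equality)
        have "0 - f \<in> X" by (intro poly_ideal_diff[OF X] poly_idealD(2)[OF X] that)
        then show "- f \<in> carrier ?R" "f \<in> carrier ?R"
          using poly_idealD(1)[OF X] that by (auto simp: carrier_plucker_ring)
      qed (simp add: plucker_ring_simps)
      show "subgroup X (add_monoid ?R)"
      proof (rule R.add.subgroupI)
        show "X \<subseteq> carrier ?R" "X \<noteq> {}" using poly_idealD(1,2)[OF X] by (auto simp: carrier_plucker_ring)
        show "\<ominus>\<^bsub>?R\<^esub> f \<in> X" if "f \<in> X" for f
          using poly_ideal_diff[OF X poly_idealD(2)[OF X] that] inv[OF that] by simp
        show "f \<oplus>\<^bsub>?R\<^esub> g \<in> X" if "f \<in> X" "g \<in> X" for f g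
          using poly_idealD(3)[OF X that] by (simp add: plucker_ring_simps)
      qed
      show "x \<otimes>\<^bsub>?R\<^esub> f \<in> X" "f \<otimes>\<^bsub>?R\<^esub> x \<in> X" if "f \<in> X" "x \<in> carrier ?R" for f x
        using poly_ideal_times[OF X, of x f] that by (simp_all add: plucker_ring_simps carrier_plucker_ring mult.commute)
    qed
  }
qed

lemma genideal_plucker_ring: "Idl\<^bsub>plucker_ring k n\<^esub> A = ideal_gen (plucker_index k n) A"
  by (simp add: genideal_def ideal_gen_def ideal_plucker_ring_iff)

lemma weight_of_weight: "weight_of k n = weight (plucker_index k n)"
  by (intro ext) (simp add: weight_of_def weight_def)

lemma initial_ideal_eq_init_ideal:
  "initial_ideal k n w I = init_ideal (plucker_index k n) (weight_less (plucker_index k n) w) I"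
proof -
  have "weight_less (plucker_index k n) w = (\<lambda>u v. weight_of k n w u < weight_of k n w v)"
    by (intro ext) (simp add: weight_less_def weight_of_weight)
  then show ?thesis by (simp add: initial_ideal_def init_ideal_def genideal_plucker_ring)
qed

lemma homogeneous_of_degree_deg: "homogeneous_of_degree e f \<longleftrightarrow> (\<forall>u\<in>supp f. deg u = e)"
  by (simp add: homogeneous_of_degree_def deg_def)

lemma plucker_ideal_poly_ideal: "poly_ideal (plucker_index k n) (plucker_ideal k n)"
  and plucker_ideal_graded: "graded (plucker_ideal k n)"
  unfolding plucker_ideal_def genideal_plucker_ring carrier_plucker_ring
  by (rule poly_ideal_ideal_gen, force, rule ideal_gen_homogeneous_graded,
      auto simp: homogeneous_def homogeneous_of_degree_deg)

section \<open>Evaluation of polynomials\<close>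

definition monval :: "('x \<Rightarrow> 'a::comm_monoid_mult) \<Rightarrow> ('x \<Rightarrow>\<^sub>0 nat) \<Rightarrow> 'a" where
  "monval a u = (\<Prod>x\<in>supp u. a x ^ cf u x)"

lemma monval_on: "finite U \<Longrightarrow> supp u \<subseteq> U \<Longrightarrow> monval a u = (\<Prod>x\<in>U. a x ^ cf u x)"
  unfolding monval_def by (rule prod.mono_neutral_left) (auto simp: in_keys_iff)

lemma monval_add: "monval a (u + v) = monval a u * monval a v"
proof -
  let ?U = "supp u \<union> supp v"
  have "monval a (u + v) = (\<Prod>x\<in>?U. a x ^ cf (u + v) x)"
    using Poly_Mapping.keys_add[of u v] by (intro monval_on) auto
  also have "\<dots> = monval a u * monval a v"
    by (simp add: monval_on[of ?U] lookup_add power_add prod.distrib)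
  finally show ?thesis .
qed

lemma mpoly_eval_monval: "mpoly_eval f a = (\<Sum>u\<in>supp f. cf f u * monval a u)"
  by (simp add: mpoly_eval_def monval_def)

lemma mpoly_eval_on: "finite U \<Longrightarrow> supp f \<subseteq> U \<Longrightarrow> mpoly_eval f a = (\<Sum>u\<in>U. cf f u * monval a u)"
  unfolding mpoly_eval_monval by (rule sum.mono_neutral_left) (auto simp: in_keys_iff)

lemma mpoly_eval_add: "mpoly_eval (f + g) a = mpoly_eval f a + mpoly_eval g a"
proof -
  let ?U = "supp f \<union> supp g"
  have "mpoly_eval (f + g) a = (\<Sum>u\<in>?U. cf (f + g) u * monval a u)"
    using Poly_Mapping.keys_add[of f g] by (intro mpoly_eval_on) auto
  also have "\<dots> = mpoly_eval f a + mpoly_eval g a"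
    by (simp add: mpoly_eval_on[of ?U] lookup_add sum.distrib algebra_simps)
  finally show ?thesis .
qed

lemma mpoly_eval_zero: "mpoly_eval 0 a = 0"
  by (simp add: mpoly_eval_def)

lemma mpoly_eval_one: "mpoly_eval 1 a = 1"
  by (simp add: mpoly_eval_def)

lemma mpoly_eval_mvar: "mpoly_eval (mvar x) a = a x"
  by (simp add: mpoly_eval_def mvar_def)

lemma mpoly_eval_sum: "mpoly_eval (\<Sum>i\<in>A. f i) a = (\<Sum>i\<in>A. mpoly_eval (f i) a)"
  by (induction A rule: infinite_finite_induct) (simp_all add: mpoly_eval_zero mpoly_eval_add)

lemma mpoly_eval_monom_times: "mpoly_eval (mterm s c * f) a = c * monval a s * mpoly_eval f a"
proof -
  have "mpoly_eval (mterm s c * f) a = (\<Sum>w\<in>(+) s ` supp f. cf (mterm s c * f) w * monval a w)"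
    by (rule mpoly_eval_on) (auto simp: supp_monom_times)
  also have "\<dots> = (\<Sum>u\<in>supp f. cf (mterm s c * f) (s + u) * monval a (s + u))"
    by (subst sum.reindex) (auto simp: inj_on_def)
  also have "\<dots> = c * monval a s * mpoly_eval f a"
    unfolding cf_monom_times_add(1) monval_add mpoly_eval_monval sum_distrib_left by (simp add: algebra_simps)
  finally show ?thesis .
qed

lemma mpoly_eval_mult: "mpoly_eval (f * g) a = mpoly_eval f a * mpoly_eval g a"
proof -
  have "f * g = (\<Sum>u\<in>supp f. mterm u (cf f u) * g)"
    using arg_cong[OF mpoly_eq_sum_monoms[of f], of "\<lambda>q. q * g"] by (simp add: sum_distrib_right)
  then have "mpoly_eval (f * g) a = (\<Sum>u\<in>supp f. cf f u * monval a u * mpoly_eval g a)"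
    by (simp add: mpoly_eval_sum mpoly_eval_monom_times)
  then show ?thesis by (simp add: mpoly_eval_monval[of f] sum_distrib_right)
qed

lemma comm_ring_hom_mpoly_eval: "comm_ring_hom (\<lambda>f. mpoly_eval f a)"
  by unfold_locales (simp_all add: mpoly_eval_zero mpoly_eval_one mpoly_eval_add mpoly_eval_mult)

lemma mpoly_eval_cong:
  assumes "f \<in> polys V" "\<And>x. x \<in> V \<Longrightarrow> a x = b x" shows "mpoly_eval f a = mpoly_eval f b"
proof -
  have "monval a u = monval b u" if "u \<in> supp f" for u
    unfolding monval_def using assms polysD[OF assms(1) that] by (intro prod.cong) (auto simp: exps_def)
  then show ?thesis by (simp add: mpoly_eval_monval)
qed

text \<open>Pluecker coordinates are determined up to a common scalar only; this is why homogeneous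
polynomials may be evaluated at them.\<close>

lemma mpoly_eval_scale:
  assumes "\<And>u. u \<in> supp f \<Longrightarrow> deg u = e"
  shows "mpoly_eval f (\<lambda>x. c * a x) = c ^ e * mpoly_eval f a"
proof -
  have "monval (\<lambda>x. c * a x) u = c ^ e * monval a u" if "u \<in> supp f" for u
    using assms[OF that] by (simp add: monval_def power_mult_distrib prod.distrib deg_def power_sum[symmetric])
  then show ?thesis by (simp add: mpoly_eval_monval sum_distrib_left algebra_simps)
qed

lemma poly_ideal_vanishing: "poly_ideal V {f \<in> polys V. mpoly_eval f a = 0}"
  unfolding poly_ideal_def
  by (auto simp: polys_zero mpoly_eval_zero polys_add mpoly_eval_add polys_monom_times mpoly_eval_monom_times)

lemma polys_mult: assumes "f \<in> polys V" "g \<in> polys V" shows "f * g \<in> polys V"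
  by (rule poly_ideal_times[OF poly_ideal_polys assms])

lemma polys_one: "1 \<in> polys V"
  by (simp add: polys_def exps_zero)

lemma polys_mvar: "x \<in> V \<Longrightarrow> mvar x \<in> polys V"
  by (simp add: polys_def mvar_def exps_def)

lemma polys_sum: "(\<And>i. i \<in> A \<Longrightarrow> f i \<in> polys V) \<Longrightarrow> sum f A \<in> polys V"
  by (rule poly_ideal_sum[OF poly_ideal_polys])

lemma polys_prod: "(\<And>i. i \<in> A \<Longrightarrow> f i \<in> polys V) \<Longrightarrow> prod f A \<in> polys V"
  by (induction A rule: infinite_finite_induct) (auto simp: polys_one polys_mult)

lemma polys_uminus: "f \<in> polys V \<Longrightarrow> - f \<in> polys V"
  by (simp add: polys_def)

section \<open>Maximal minors and column spaces\<close>

lemma pick_lessThan: "j < k \<Longrightarrow> pick {..<k} j = j"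
proof (induction j)
  case 0
  then show ?case by (auto intro: Least_equality)
next
  case (Suc j)
  then show ?case by (auto intro: Least_equality)
qed

lemma submatrix_plucker:
  assumes J: "J \<in> plucker_index k n" and A: "dim_row A = n" "k \<le> dim_col A"
  shows "submatrix A J {..<k} = mat k k (\<lambda>(i, j). A $$ (pick J i, j))"
proof -
  have J': "J \<subseteq> {..<n}" "card J = k" using J by (auto simp: plucker_index_def)
  have "{i. i < n \<and> i \<in> J} = J" using J' by auto
  moreover have "{j. j < dim_col A \<and> j \<in> {..<k}} = {..<k}" using A by auto
  ultimately show ?thesis
    unfolding submatrix_def using A J' by (intro eq_matI) (auto simp: pick_lessThan)
qed

lemma pick_plucker: "J \<in> plucker_index k n \<Longrightarrow> i < k \<Longrightarrow> pick J i < n"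
  using pick_in_set_le[of i J] by (auto simp: plucker_index_def)

lemma minor_plucker:
  assumes "J \<in> plucker_index k n" "dim_row A = n" "k \<le> dim_col A"
  shows "minor k A J = Determinant.det (mat k k (\<lambda>(i, j). A $$ (pick J i, j)))"
  unfolding minor_def submatrix_plucker[OF assms] ..

lemma minor_mult:
  fixes A :: "'a::comm_ring_1 mat"
  assumes A: "A \<in> carrier_mat n k" and g: "g \<in> carrier_mat k k" and J: "J \<in> plucker_index k n"
  shows "minor k (A * g) J = minor k A J * Determinant.det g"
proof -
  let ?M = "\<lambda>A. mat k k (\<lambda>(i, j). A $$ (pick J i, j))"
  have "?M (A * g) = ?M A * g"
    using A g pick_plucker[OF J] by (intro eq_matI) (auto simp: scalar_prod_def)
  moreover have "?M A \<in> carrier_mat k k" by simp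
  ultimately show ?thesis
    using A g minor_plucker[OF J, of A] minor_plucker[OF J, of "A * g"] det_mult[of "?M A" k g] by auto
qed

text \<open>Every column of \<open>A'\<close> is a linear combination of the columns of \<open>A\<close>.\<close>

lemma col_space_subset_mult:
  fixes A A' :: "complex mat"
  assumes A: "A \<in> carrier_mat n k" and A': "A' \<in> carrier_mat n k"
    and eq: "vec_space.col_space n A' = vec_space.col_space n A"
  shows "\<exists>g\<in>carrier_mat k k. A' = A * g"
proof -
  have "\<exists>x\<in>carrier_vec k. A *\<^sub>v x = col A' j" if j: "j < k" for j
  proof -
    have "A' *\<^sub>v unit_vec k j = col A' j" using A' j by (intro eq_vecI) auto
    then have "col A' j \<in> vec_space.col_space n A'"
      unfolding vec_space.col_space_eq[OF A'] using A' j by auto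
    then show ?thesis unfolding eq vec_space.col_space_eq[OF A] using A by auto
  qed
  then obtain x where x: "\<And>j. j < k \<Longrightarrow> x j \<in> carrier_vec k \<and> A *\<^sub>v x j = col A' j" by metis
  let ?g = "mat k k (\<lambda>(i, j). x j $ i)"
  have "A' = A * ?g"
  proof (rule eq_matI)
    fix i j assume "i < dim_row (A * ?g)" "j < dim_col (A * ?g)"
    then have ij: "i < n" "j < k" using A by auto
    have "col ?g j = x j" using x[OF ij(2)] ij(2) by (intro eq_vecI) auto
    then have "(A * ?g) $$ (i, j) = (A *\<^sub>v x j) $ i" using A ij by auto
    also have "\<dots> = A' $$ (i, j)" using x[OF ij(2)] A' ij by simp
    finally show "A' $$ (i, j) = (A * ?g) $$ (i, j)" by simp
  qed (use A A' in auto)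
  then show ?thesis by (intro bexI[of _ ?g]) auto
qed

text \<open>Write \<open>A' = A g\<close>. If \<open>det g = 0\<close>, all maximal minors of both matrices vanish, and the factor \<open>1\<close> serves.\<close>

lemma minors_proportional:
  assumes A: "A \<in> carrier_mat n k" and A': "A' \<in> carrier_mat n k"
    and eq: "vec_space.col_space n A' = vec_space.col_space n (A :: complex mat)"
  shows "\<exists>c. c \<noteq> 0 \<and> (\<forall>J\<in>plucker_index k n. minor k A' J = c * minor k A J)"
proof -
  obtain g where g: "g \<in> carrier_mat k k" "A' = A * g" using col_space_subset_mult[OF A A' eq] by auto
  obtain h where h: "h \<in> carrier_mat k k" "A = A' * h" using col_space_subset_mult[OF A' A eq[symmetric]] by auto
  have 1: "minor k A' J = Determinant.det g * minor k A J" if "J \<in> plucker_index k n" for J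
    using minor_mult[OF A g(1) that] g(2) by simp
  have 2: "minor k A J = Determinant.det h * minor k A' J" if "J \<in> plucker_index k n" for J
    using minor_mult[OF A' h(1) that] h(2) by simp
  show ?thesis
  proof (cases "Determinant.det g = 0")
    case True
    then have "\<forall>J\<in>plucker_index k n. minor k A' J = 1 * minor k A J" using 1 2 by simp
    then show ?thesis by (intro exI[of _ 1]) simp
  next
    case False
    then show ?thesis using 1 by blast
  qed
qed

lemma plucker_coords_proportional:
  assumes A: "A \<in> carrier_mat n k"
  shows "\<exists>c. c \<noteq> 0 \<and> (\<forall>J\<in>plucker_index k n. plucker_coords k n (vec_space.col_space n A) J = c * minor k A J)"
proof -
  let ?P = "\<lambda>A'. A' \<in> carrier_mat n k \<and> vec_space.col_space n A' = vec_space.col_space n A"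
  have "?P (Eps ?P)" using A by (intro someI[of ?P A]) simp
  then show ?thesis unfolding plucker_coords_def using minors_proportional[OF A] by blast
qed

lemma col_space_grassmannian:
  fixes A :: "complex mat"
  assumes A: "A \<in> carrier_mat n k" and J: "J \<in> plucker_index k n" and ne: "minor k A J \<noteq> 0"
  shows "vec_space.col_space n A \<in> grassmannian k n"
proof -
  interpret vec_space "TYPE(complex)" n .
  have cols: "set (cols A) \<subseteq> carrier_vec n" using A by (metis carrier_matD(1) cols_dim)
  have "{j. j < k \<and> j \<in> {..<k}} = {..<k}" by auto
  then have "k \<le> rank A" using rank_gt_minor[OF A, of J "{..<k}"] ne by (simp add: minor_def)
  then have "rank A = k" using rank_le_nc[OF A] by simp
  then show ?thesis
    unfolding grassmannian_def using span_is_subspace[OF cols] by (simp add: rank_def col_space_def)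
qed

section \<open>The matrix of a root sequence\<close>

lemma psi_carrier: "psi n S y \<in> carrier_mat n n"
proof -
  have "foldr (*) (map (\<lambda>a. 1\<^sub>m n + y a \<cdot>\<^sub>m root_mat n (S ! a)) xs) (1\<^sub>m n) \<in> carrier_mat n n" for xs
    by (induction xs) (auto simp: root_mat_def)
  then show ?thesis by (simp add: psi_def)
qed

text \<open>Evaluation is a ring homomorphism, so it may be applied to the entries of the factors.\<close>

lemma psi_eval: "map_mat (\<lambda>f. mpoly_eval f y) (psi n S mvar) = psi n S y"
proof -
  interpret comm_ring_hom "\<lambda>f. mpoly_eval f y" by (rule comm_ring_hom_mpoly_eval)
  have c: "foldr (*) (map (\<lambda>a. 1\<^sub>m n + z a \<cdot>\<^sub>m root_mat n (S ! a)) xs) (1\<^sub>m n) \<in> carrier_mat n n"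
    for xs and z :: "nat \<Rightarrow> 'b::comm_ring_1"
    by (induction xs) (auto simp: root_mat_def)
  have f: "map_mat (\<lambda>f. mpoly_eval f y) (1\<^sub>m n + mvar a \<cdot>\<^sub>m root_mat n \<beta>) = 1\<^sub>m n + y a \<cdot>\<^sub>m root_mat n \<beta>" for a \<beta>
    by (rule eq_matI) (auto simp: root_mat_def mpoly_eval_mvar mpoly_eval_zero mpoly_eval_one mpoly_eval_add mpoly_eval_mult)
  have m: "1\<^sub>m n + z a \<cdot>\<^sub>m root_mat n \<beta> \<in> carrier_mat n n" for a \<beta> and z :: "nat \<Rightarrow> 'b::comm_ring_1"
    by (simp add: root_mat_def)
  have "map_mat (\<lambda>f. mpoly_eval f y) (foldr (*) (map (\<lambda>a. 1\<^sub>m n + mvar a \<cdot>\<^sub>m root_mat n (S ! a)) xs) (1\<^sub>m n))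
    = foldr (*) (map (\<lambda>a. 1\<^sub>m n + y a \<cdot>\<^sub>m root_mat n (S ! a)) xs) (1\<^sub>m n)" for xs
  proof (induction xs)
    case (Cons a xs)
    then show ?case using mat_hom_mult[OF m c] f by simp
  qed (simp add: mat_hom_one)
  then show ?thesis by (simp add: psi_def)
qed

lemma polys_det:
  assumes "A \<in> carrier_mat m m" "\<And>i j. i < m \<Longrightarrow> j < m \<Longrightarrow> A $$ (i, j) \<in> polys V"
  shows "Determinant.det A \<in> polys V"
  unfolding det_def'[OF assms(1)]
proof (rule polys_sum, rule polys_mult)
  fix p assume "p \<in> {p. p permutes {0..<m}}"
  then have p: "p permutes {0..<m}" by simp
  show "signof p \<in> polys V" by (auto simp: sign_def polys_one polys_uminus)
  show "(\<Prod>i = 0..<m. A $$ (i, p i)) \<in> polys V"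
    using permutes_in_image[OF p] by (intro polys_prod assms(2)) auto
qed

lemma polys_psi:
  assumes "i < n" "j < n" shows "psi n S mvar $$ (i, j) \<in> polys {..<length S}"
proof -
  have "(\<forall>i<n. \<forall>j<n. foldr (*) (map (\<lambda>a. 1\<^sub>m n + mvar a \<cdot>\<^sub>m root_mat n (S ! a)) xs) (1\<^sub>m n) $$ (i, j) \<in> polys V) \<and>
      foldr (*) (map (\<lambda>a. 1\<^sub>m n + mvar a \<cdot>\<^sub>m root_mat n (S ! a)) xs) (1\<^sub>m n) \<in> carrier_mat n n"
    if "set xs \<subseteq> V" for xs and V :: "nat set"
    using that
  proof (induction xs)
    case Nil
    then show ?case by (auto simp: polys_one polys_zero)
  next
    case (Cons a xs)
    define B where "B = foldr (*) (map (\<lambda>a. 1\<^sub>m n + (mvar a :: nat mpoly) \<cdot>\<^sub>m root_mat n (S ! a)) xs) (1\<^sub>m n)"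
    define F where "F = 1\<^sub>m n + (mvar a :: nat mpoly) \<cdot>\<^sub>m root_mat n (S ! a)"
    have B: "B \<in> carrier_mat n n" "\<And>i j. i < n \<Longrightarrow> j < n \<Longrightarrow> B $$ (i, j) \<in> polys V"
      using Cons by (auto simp: B_def)
    have F: "F \<in> carrier_mat n n" "\<And>i j. i < n \<Longrightarrow> j < n \<Longrightarrow> F $$ (i, j) \<in> polys V"
      using Cons.prems by (auto simp: F_def root_mat_def intro!: polys_add polys_mult polys_mvar simp: polys_one polys_zero)
    have "(F * B) $$ (i, j) \<in> polys V" if "i < n" "j < n" for i j
      using that B F by (auto simp: scalar_prod_def intro!: polys_sum polys_mult)
    moreover have "F * B \<in> carrier_mat n n" using B F by auto
    ultimately show ?case by (simp add: B_def F_def)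
  qed
  from this[of "[0..<length S]" "{..<length S}"] show ?thesis using assms by (simp add: psi_def atLeast0LessThan)
qed

lemma polys_minor_psi:
  assumes J: "J \<in> plucker_index k n" and "k \<le> n"
  shows "minor k (psi n S mvar) J \<in> polys {..<length S}"
proof -
  have "psi n S (mvar :: nat \<Rightarrow> nat mpoly) \<in> carrier_mat n n" by (rule psi_carrier)
  then show ?thesis
    using assms pick_plucker[OF J] by (subst minor_plucker[OF J]) (auto intro!: polys_det polys_psi)
qed

lemma minor_map_mat:
  assumes "comm_ring_hom h" and A: "A \<in> carrier_mat n m" "k \<le> m" and J: "J \<in> plucker_index k n"
  shows "minor k (map_mat h A) J = h (minor k A J)"
proof -
  interpret comm_ring_hom h by fact
  let ?M = "mat k k (\<lambda>(i, j). A $$ (pick J i, j))"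
  have "h (minor k A J) = h (Determinant.det ?M)"
    using A by (simp add: minor_plucker[OF J])
  also have "\<dots> = Determinant.det (map_mat h ?M)"
    by (rule hom_det[symmetric])
  also have "map_mat h ?M = mat k k (\<lambda>(i, j). map_mat h A $$ (pick J i, j))"
    using A pick_plucker[OF J] by (intro eq_matI) auto
  also have "Determinant.det \<dots> = minor k (map_mat h A) J"
    using A by (simp add: minor_plucker[OF J])
  finally show ?thesis ..
qed

lemma minor_psi_eval:
  assumes J: "J \<in> plucker_index k n" and "k \<le> n"
  shows "mpoly_eval (minor k (psi n S mvar) J) y = minor k (psi n S y) J"
  using minor_map_mat[OF comm_ring_hom_mpoly_eval[of y] psi_carrier assms(2) J, of S mvar] by (simp add: psi_eval)

text \<open>\<open>param_map\<close> is the column space of this \<open>n \<times> k\<close> matrix, which has the same maximal minors as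
\<open>psi n S y\<close>.\<close>

definition first_cols :: "nat \<Rightarrow> nat \<Rightarrow> root_seq \<Rightarrow> (nat \<Rightarrow> complex) \<Rightarrow> complex mat" where
  "first_cols k n S y = submatrix (psi n S y) {..<n} {..<k}"

lemma
  assumes "k \<le> n"
  shows first_cols_carrier: "first_cols k n S y \<in> carrier_mat n k"
    and minor_first_cols: "J \<in> plucker_index k n \<Longrightarrow> minor k (first_cols k n S y) J = minor k (psi n S y) J"
proof -
  have P: "psi n S y \<in> carrier_mat n n" by (rule psi_carrier)
  have "{i. i < n \<and> i \<in> {..<n}} = {..<n}" "{i. i < n \<and> i \<in> {..<k}} = {..<k}" using assms by auto
  then have eq: "first_cols k n S y = mat n k (\<lambda>(i, j). psi n S y $$ (i, j))"
    using P assms unfolding first_cols_def submatrix_def by (intro eq_matI) (auto simp: pick_lessThan)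
  then show C: "first_cols k n S y \<in> carrier_mat n k" by simp
  show "minor k (first_cols k n S y) J = minor k (psi n S y) J" if J: "J \<in> plucker_index k n"
    using P C assms pick_plucker[OF J]
    by (simp add: minor_plucker[OF J] del: eq) (auto simp: eq intro!: arg_cong[of _ _ Determinant.det] eq_matI)
qed

lemma param_map_first_cols: "param_map k n S y = vec_space.col_space n (first_cols k n S y)"
  by (simp add: param_map_def first_cols_def)

section \<open>Birational parametrizations\<close>

lemma eval_plucker_coords:
  assumes A: "A \<in> carrier_mat n k" and f: "f \<in> carrier (plucker_ring k n)" "homogeneous_of_degree e f"
  shows "mpoly_eval f (plucker_coords k n (vec_space.col_space n A)) = 0 \<longleftrightarrow> mpoly_eval f (minor k A) = 0"
proof -
  obtain c where c: "c \<noteq> 0" "\<And>J. J \<in> plucker_index k n \<Longrightarrow> plucker_coords k n (vec_space.col_space n A) J = c * minor k A J"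
    using plucker_coords_proportional[OF A] by blast
  have "mpoly_eval f (plucker_coords k n (vec_space.col_space n A)) = mpoly_eval f (\<lambda>J. c * minor k A J)"
    using f(1) c(2) unfolding carrier_plucker_ring by (rule mpoly_eval_cong)
  also have "\<dots> = c ^ e * mpoly_eval f (minor k A)"
    using f(2) by (intro mpoly_eval_scale) (simp add: homogeneous_of_degree_deg)
  finally show ?thesis using c(1) by simp
qed

text \<open>Evaluation at \<open>t\<close> is a ring homomorphism, so the minors of the matrix whose entries are the affine
polynomials interpolating \<open>A0\<close> and \<open>A1\<close> evaluate to the minors along the line through \<open>A0\<close> and \<open>A1\<close>.\<close>

lemma poly_minor_line:
  fixes A0 A1 :: "complex mat"
  assumes "A0 \<in> carrier_mat n k" "A1 \<in> carrier_mat n k"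
  shows "\<exists>A q. (\<forall>t. A t \<in> carrier_mat n k) \<and> A 0 = A0 \<and> A 1 = A1 \<and>
    (\<forall>J\<in>plucker_index k n. \<forall>t. minor k (A t) J = poly (q J) t)"
proof -
  define B where "B = mat n k (\<lambda>ij. [:A0 $$ ij, A1 $$ ij - A0 $$ ij:])"
  define A where "A = (\<lambda>t. map_mat (\<lambda>p. poly p t) B)"
  have B: "B \<in> carrier_mat n k" by (simp add: B_def)
  have "comm_ring_hom (\<lambda>p. poly p t)" for t :: complex by unfold_locales simp_all
  then have "minor k (A t) J = poly (minor k B J) t" if "J \<in> plucker_index k n" for t J
    unfolding A_def by (rule minor_map_mat[OF _ B order_refl that])
  moreover have "A 0 = A0" "A 1 = A1" using assms by (auto simp: A_def B_def intro!: eq_matI)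
  moreover have "A t \<in> carrier_mat n k" for t using B by (simp add: A_def)
  ultimately show ?thesis by (intro exI[of _ A] exI[of _ "minor k B"]) blast
qed

lemma poly_mpoly_eval:
  "poly (\<Sum>u\<in>supp f. [:cf f u:] * monval q u) t = mpoly_eval f (\<lambda>x. poly (q x) t)"
  by (simp add: mpoly_eval_monval poly_sum monval_def poly_prod)

text \<open>The rows in \<open>J\<close> form an identity matrix; the others are zero.\<close>

lemma ex_minor_one:
  assumes J: "J \<in> plucker_index k n"
  shows "\<exists>A\<in>carrier_mat n k. minor k A J = (1 :: complex)"
proof -
  let ?A = "mat n k (\<lambda>(i, j). if i = pick J j then 1 else (0 :: complex))"
  have "pick J i = pick J j \<longleftrightarrow> i = j" if "i < k" "j < k" for i j
    using that J pick_mono_le[of i J j] pick_mono_le[of j J i]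
    by (cases i j rule: linorder_cases) (auto simp: plucker_index_def)
  then have "mat k k (\<lambda>(i, j). ?A $$ (pick J i, j)) = 1\<^sub>m k"
    using pick_plucker[OF J] by (intro eq_matI) auto
  then have "minor k ?A J = 1" by (simp add: minor_plucker[OF J])
  then show ?thesis by (intro bexI[of _ ?A]) simp_all
qed

text \<open>This is the irreducibility of the Grassmannian, in the form of a line joining a point
\<open>W\<^sub>0\<close> where the inverse map is defined to a point whose \<open>J\<close>-th Pluecker coordinate is nonzero. All but finitely many points
\<open>W\<close> on the line have both properties, and \<open>W\<close> is the image under the parametrization of its image under the inverse map.\<close>

lemma minor_psi_nonzero:
  assumes bir: "birational_seq k n S" and k: "k \<le> n" and J: "J \<in> plucker_index k n"
  shows "\<exists>y. minor k (psi n S y) J \<noteq> (0 :: complex)"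
proof -
  let ?pc = "plucker_coords k n"
  from bir obtain F G y0 where FG: "\<forall>a<length S. F a \<in> carrier (plucker_ring k n) \<and>
      G a \<in> carrier (plucker_ring k n) \<and>
      (\<exists>e. homogeneous_of_degree e (F a) \<and> homogeneous_of_degree e (G a))"
    and y0: "\<forall>a<length S. mpoly_eval (G a) (?pc (param_map k n S y0)) \<noteq> 0"
    and inv: "\<forall>W\<in>grassmannian k n. (\<forall>a<length S. mpoly_eval (G a) (?pc W) \<noteq> 0) \<longrightarrow>
      param_map k n S (\<lambda>a. mpoly_eval (F a) (?pc W) / mpoly_eval (G a) (?pc W)) = W"
    unfolding birational_seq_def Let_def by (elim conjE exE)
  have G: "G a \<in> carrier (plucker_ring k n)" "\<exists>e. homogeneous_of_degree e (G a)" if "a < length S" for a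
    using FG that by blast+
  have defined_iff: "mpoly_eval (G a) (?pc (vec_space.col_space n A)) = 0 \<longleftrightarrow> mpoly_eval (G a) (minor k A) = 0"
    if "a < length S" "A \<in> carrier_mat n k" for a A
    using G[OF that(1)] eval_plucker_coords[OF that(2)] by blast
  obtain A1 where A1: "A1 \<in> carrier_mat n k" "minor k A1 J = (1 :: complex)" using ex_minor_one[OF J] by blast
  obtain A q where A: "\<And>t. A t \<in> carrier_mat n k" "A 0 = first_cols k n S y0" "A 1 = A1"
    and q: "\<And>J t. J \<in> plucker_index k n \<Longrightarrow> minor k (A t) J = poly (q J) t"
    using poly_minor_line[OF first_cols_carrier[OF k, of S y0] A1(1)] by blast
  \<comment> \<open>\<open>G a\<close> along the line, as a polynomial in the parameter \<open>t\<close>\<close>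
  define Q where "Q = (\<lambda>a. \<Sum>u\<in>supp (G a). [:cf (G a) u:] * monval q u)"
  have Q: "poly (Q a) t = mpoly_eval (G a) (minor k (A t))" if a: "a < length S" for a t
    unfolding Q_def poly_mpoly_eval using G(1)[OF a] q unfolding carrier_plucker_ring
    by (intro mpoly_eval_cong[of "G a"]) auto
  have "poly (q J) 1 \<noteq> 0" using q[OF J, of 1] A(3) A1(2) by simp
  then have "q J \<noteq> 0" by auto
  moreover have "poly (Q a) 0 \<noteq> 0" if a: "a < length S" for a
    using y0 a defined_iff[OF a A(1)[of 0]] Q[OF a] A(2) by (simp add: param_map_first_cols)
  then have "Q a \<noteq> 0" if "a < length S" for a using that by fastforce
  ultimately have "q J * (\<Prod>a<length S. Q a) \<noteq> 0" by (auto simp: prod_zero_iff)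
  then obtain t where "poly (q J * (\<Prod>a<length S. Q a)) t \<noteq> 0" using poly_all_0_iff_0 by blast
  then have t: "minor k (A t) J \<noteq> 0" "\<And>a. a < length S \<Longrightarrow> mpoly_eval (G a) (minor k (A t)) \<noteq> 0"
    using q[OF J] Q by (auto simp: poly_prod)
  let ?W = "vec_space.col_space n (A t)"
  have "\<forall>a<length S. mpoly_eval (G a) (?pc ?W) \<noteq> 0"
    using t(2) defined_iff[OF _ A(1)] by blast
  then obtain y where "param_map k n S y = ?W"
    using bspec[OF inv col_space_grassmannian[OF A(1) J t(1)]] by blast
  then have "vec_space.col_space n (first_cols k n S y) = ?W" by (simp add: param_map_first_cols)
  then have "minor k (first_cols k n S y) J \<noteq> 0"
    using minors_proportional[OF A(1) first_cols_carrier[OF k]] t(1) J by force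
  then show ?thesis using minor_first_cols[OF k J] by auto
qed

text \<open>The nonvanishing minor ensures that the first \<open>k\<close> columns span a point of the Grassmannian. The
polynomials vanishing at the minors form an ideal that contains the generators of the Pluecker ideal.\<close>

lemma plucker_ideal_vanishes:
  assumes k: "k \<le> n" and f: "f \<in> plucker_ideal k n"
    and J: "J \<in> plucker_index k n" "minor k (psi n S y) J \<noteq> (0 :: complex)"
  shows "mpoly_eval f (minor k (psi n S y)) = 0"
proof -
  let ?V = "plucker_index k n"
  let ?A = "{f \<in> carrier (plucker_ring k n). (\<exists>e. homogeneous_of_degree e f) \<and>
      (\<forall>W\<in>grassmannian k n. mpoly_eval f (plucker_coords k n W) = 0)}"
  have eq: "mpoly_eval f (minor k (first_cols k n S y)) = mpoly_eval f (minor k (psi n S y))" if "f \<in> polys ?V" for f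
    using that minor_first_cols[OF k] by (intro mpoly_eval_cong) auto
  have "minor k (first_cols k n S y) J \<noteq> 0" using J minor_first_cols[OF k] by simp
  then have W: "vec_space.col_space n (first_cols k n S y) \<in> grassmannian k n"
    by (rule col_space_grassmannian[OF first_cols_carrier[OF k] J(1)])
  have "?A \<subseteq> {f \<in> polys ?V. mpoly_eval f (minor k (psi n S y)) = 0}"
    using W eval_plucker_coords[OF first_cols_carrier[OF k, of S y]] eq by (force simp: carrier_plucker_ring)
  then have "ideal_gen ?V ?A \<subseteq> {f \<in> polys ?V. mpoly_eval f (minor k (psi n S y)) = 0}"
    by (rule ideal_gen_least[OF poly_ideal_vanishing])
  then show ?thesis using f unfolding plucker_ideal_def genideal_plucker_ring by blast
qed

section \<open>Linear functionals that imitate the order on exponents\<close>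

text \<open>By recursion on the number of coordinates: the weight of the first coordinate has to exceed the
absolute value of what the remaining ones can contribute on \<open>D\<close>.\<close>

lemma lex_weights:
  fixes D :: "(nat \<Rightarrow> int) set"
  assumes "finite D"
  shows "\<exists>c :: nat \<Rightarrow> nat. \<forall>\<delta>\<in>D. (\<exists>a<d. 0 < \<delta> a \<and> (\<forall>b<a. \<delta> b = 0)) \<longrightarrow> 0 < (\<Sum>a<d. int (c a) * \<delta> a)"
  using assms
proof (induction d arbitrary: D)
  case (Suc d)
  obtain c :: "nat \<Rightarrow> nat" where c: "\<And>\<delta>. \<delta> \<in> D \<Longrightarrow> (\<exists>a<d. 0 < \<delta> (Suc a) \<and> (\<forall>b<a. \<delta> (Suc b) = 0)) \<Longrightarrow>
      0 < (\<Sum>a<d. int (c a) * \<delta> (Suc a))"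
    using Suc.IH[of "(\<lambda>\<delta> a. \<delta> (Suc a)) ` D"] Suc.prems by auto
  let ?s = "\<lambda>\<delta>. \<Sum>a<d. int (c a) * \<delta> (Suc a)"
  \<comment> \<open>exceeds every contribution of the later coordinates on \<open>D\<close>\<close>
  define C where "C = nat (1 + (\<Sum>\<delta>\<in>D. \<bar>?s \<delta>\<bar>))"
  have C: "int C = 1 + (\<Sum>\<delta>\<in>D. \<bar>?s \<delta>\<bar>)" unfolding C_def by (simp add: sum_nonneg)
  have "0 < (\<Sum>a<Suc d. int (case_nat C c a) * \<delta> a)"
    if \<delta>: "\<delta> \<in> D" and ex: "\<exists>a<Suc d. 0 < \<delta> a \<and> (\<forall>b<a. \<delta> b = 0)" for \<delta>
  proof -
    have eq: "(\<Sum>a<Suc d. int (case_nat C c a) * \<delta> a) = int C * \<delta> 0 + ?s \<delta>"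
      by (simp add: sum.lessThan_Suc_shift del: sum.lessThan_Suc)
    obtain a where a: "a < Suc d" "0 < \<delta> a" "\<forall>b<a. \<delta> b = 0" using ex by blast
    show ?thesis
    proof (cases a)
      case 0
      have "\<bar>?s \<delta>\<bar> < int C" using member_le_sum[OF \<delta>, of "\<lambda>\<delta>. \<bar>?s \<delta>\<bar>"] Suc.prems C by simp
      moreover have "int C * 1 \<le> int C * \<delta> 0" using a 0 by (intro mult_left_mono) auto
      ultimately show ?thesis unfolding eq by simp
    next
      case (Suc a')
      then have "0 < ?s \<delta>" using a by (intro c[OF \<delta>]) auto
      then show ?thesis unfolding eq using a Suc by simp
    qed
  qed
  then show ?case by blast
qed simp

lemma lex_greater_total:
  "lex_greater d m m' \<or> lex_greater d m' m \<or> (\<forall>a<d. m a = m' a)"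
proof (rule disjCI)
  assume "\<not> (lex_greater d m' m \<or> (\<forall>a<d. m a = m' a))"
  then obtain a where a: "a < d" "m a \<noteq> m' a" and no: "\<not> lex_greater d m' m" by blast
  define a0 where "a0 = (LEAST a. m a \<noteq> m' a)"
  have "m a0 \<noteq> m' a0" unfolding a0_def by (rule LeastI[of _ a]) (rule a)
  moreover have "a0 \<le> a" unfolding a0_def by (rule Least_le) (rule a)
  moreover have "m b = m' b" if "b < a0" for b using not_less_Least[OF that[unfolded a0_def]] by blast
  ultimately show "lex_greater d m m'"
    using no a(1) unfolding lex_greater_def by (metis le_less_trans linorder_neqE)
qed

lemma psi_less_total:
  "psi_less S m m' \<or> psi_less S m' m \<or> (\<forall>a<length S. m a = m' a)"
  using lex_greater_total[of "length S" m m'] by (auto simp: psi_less_def)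

text \<open>With weights \<open>c\<close> for the lexicographic order on differences, the functional is \<open>K \<Psi>(m) - c \<cdot> m\<close>;
the minus sign reverses the lexicographic order, as \<open>\<prec>_\<Psi>\<close> demands. All heights are at least \<open>1\<close>, so a
large \<open>K\<close> makes the coefficients nonnegative. They have to be natural numbers because
they serve as exponents of a curve later.\<close>

lemma psi_less_weights:
  assumes S: "set S \<subseteq> positive_roots n" and D: "finite D"
  shows "\<exists>E :: nat \<Rightarrow> nat. \<forall>m\<in>D. \<forall>m'\<in>D. psi_less S m m' \<longleftrightarrow>
    (\<Sum>a<length S. int (E a) * m a) < (\<Sum>a<length S. int (E a) * m' a)"
proof -
  let ?d = "length S"
  define \<Delta> where "\<Delta> = (\<lambda>(m, m') a. m a - m' a :: int) ` (D \<times> D)"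
  have fin: "finite \<Delta>" using D by (simp add: \<Delta>_def)
  obtain c :: "nat \<Rightarrow> nat" where c: "\<And>\<delta>. \<delta> \<in> \<Delta> \<Longrightarrow> (\<exists>a<?d. 0 < \<delta> a \<and> (\<forall>b<a. \<delta> b = 0)) \<Longrightarrow> 0 < (\<Sum>a<?d. int (c a) * \<delta> a)"
    using lex_weights[OF fin, of ?d] by blast
  define ht where "ht = (\<lambda>a. int (snd (S ! a)) - int (fst (S ! a)))"
  have ht: "1 \<le> ht a" if "a < ?d" for a
    using S nth_mem[OF that] by (auto simp: ht_def positive_roots_def)
  let ?c = "\<lambda>m. \<Sum>a<?d. int (c a) * m a"
  \<comment> \<open>the first sum keeps the coefficients of \<open>E\<close> nonnegative, the second lets the height dominate\<close>
  define K where "K = 1 + (\<Sum>a<?d. int (c a)) + (\<Sum>\<delta>\<in>\<Delta>. \<bar>?c \<delta>\<bar>)"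
  define E where "E = (\<lambda>a. nat (K * ht a - int (c a)))"
  have E: "int (E a) = K * ht a - int (c a)" if a: "a < ?d" for a
  proof -
    have "int (c a) \<le> (\<Sum>a<?d. int (c a))" using a by (intro member_le_sum) auto
    then have "int (c a) \<le> K" unfolding K_def using sum_nonneg[of \<Delta> "\<lambda>\<delta>. \<bar>?c \<delta>\<bar>"] by linarith
    moreover have "K * 1 \<le> K * ht a" using ht[OF a] \<open>int (c a) \<le> K\<close> by (intro mult_left_mono) auto
    ultimately show ?thesis by (simp add: E_def)
  qed
  let ?e = "\<lambda>m. \<Sum>a<?d. int (E a) * m a"
  have e: "?e m = K * height_sum S m - ?c m" for m
    by (simp add: height_sum_def E ht_def sum_distrib_left sum_subtractf[symmetric] algebra_simps)
  have mono: "?e m < ?e m'" if m: "m \<in> D" "m' \<in> D" and less: "psi_less S m m'" for m m'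
  proof -
    consider "height_sum S m < height_sum S m'" | "height_sum S m = height_sum S m'" "lex_greater ?d m m'"
      using less by (auto simp: psi_less_def)
    then show ?thesis
    proof cases
      case 1
      have mem: "(\<lambda>a. m' a - m a) \<in> \<Delta>" using m by (force simp: \<Delta>_def)
      have "\<bar>?c (\<lambda>a. m' a - m a)\<bar> \<le> (\<Sum>\<delta>\<in>\<Delta>. \<bar>?c \<delta>\<bar>)"
        using fin mem by (intro member_le_sum[where f = "\<lambda>\<delta>. \<bar>?c \<delta>\<bar>"]) auto
      then have "\<bar>?c (\<lambda>a. m' a - m a)\<bar> < K" "0 \<le> K"
        unfolding K_def using sum_nonneg[of "{..<?d}" "\<lambda>a. int (c a)"] by auto
      moreover have "?c (\<lambda>a. m' a - m a) = ?c m' - ?c m"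
        by (simp add: right_diff_distrib sum_subtractf)
      moreover have "K * 1 \<le> K * (height_sum S m' - height_sum S m)"
        using 1 \<open>0 \<le> K\<close> by (intro mult_left_mono) auto
      ultimately show ?thesis unfolding e by (simp add: right_diff_distrib)
    next
      case 2
      have "(\<lambda>a. m a - m' a) \<in> \<Delta>" using m by (force simp: \<Delta>_def)
      moreover have "\<exists>a<?d. 0 < m a - m' a \<and> (\<forall>b<a. m b - m' b = 0)"
        using 2(2) by (auto simp: lex_greater_def)
      ultimately have "0 < ?c (\<lambda>a. m a - m' a)" by (rule c)
      then show ?thesis unfolding e using 2(1) by (simp add: right_diff_distrib sum_subtractf)
    qed
  qed
  have "psi_less S m m' \<longleftrightarrow> ?e m < ?e m'" if m: "m \<in> D" "m' \<in> D" for m m'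
  proof
    assume less: "?e m < ?e m'"
    then have "\<not> psi_less S m' m" using mono[OF m(2,1)] by auto
    moreover have "?e m = ?e m'" if "\<forall>a<?d. m a = m' a" using that by simp
    then have "\<not> (\<forall>a<?d. m a = m' a)" using less by (metis less_irrefl)
    ultimately show "psi_less S m m'" using psi_less_total by blast
  qed (rule mono[OF m])
  then show ?thesis by blast
qed

text \<open>The order axioms involve few exponents at a time, and on those the order is that of a linear functional.\<close>

lemma weight_order_matrix:
  assumes S: "set S \<subseteq> positive_roots n"
  shows "weight_order (\<lambda>u v. psi_less S (matrix_times_exponent k n' M u) (matrix_times_exponent k n' M v))"
proof -
  let ?M = "matrix_times_exponent k n' M"
  have add: "(\<Sum>a<d. int (E a) * ?M (s + u) a) = (\<Sum>a<d. int (E a) * ?M s a) + (\<Sum>a<d. int (E a) * ?M u a)" for d E s u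
    by (simp add: matrix_times_exponent_def lookup_add sum.distrib algebra_simps)
  have w: "\<exists>E :: nat \<Rightarrow> nat. \<forall>x\<in>U. \<forall>y\<in>U. psi_less S (?M x) (?M y) \<longleftrightarrow>
      (\<Sum>a<length S. int (E a) * ?M x a) < (\<Sum>a<length S. int (E a) * ?M y a)" if "finite U" for U
    using psi_less_weights[OF S, of "?M ` U"] that by auto
  show ?thesis
  proof
    fix s u v w :: "nat set \<Rightarrow>\<^sub>0 nat"
    have "finite {u, v, w, s + u, s + v}" by simp
    from w[OF this] obtain E :: "nat \<Rightarrow> nat" where E0:
      "\<forall>x\<in>{u, v, w, s + u, s + v}. \<forall>y\<in>{u, v, w, s + u, s + v}. psi_less S (?M x) (?M y) \<longleftrightarrow>
        (\<Sum>a<length S. int (E a) * ?M x a) < (\<Sum>a<length S. int (E a) * ?M y a)"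
      by (elim exE)
    note E = E0[rule_format]
    show "\<not> psi_less S (?M u) (?M u)" using E[of u u] by simp
    show "psi_less S (?M u) (?M w)" if "psi_less S (?M u) (?M v)" "psi_less S (?M v) (?M w)"
      using that E[of u w] E[of u v] E[of v w] by simp
    show "psi_less S (?M u) (?M v) \<or> psi_less S (?M v) (?M w)" if "psi_less S (?M u) (?M w)"
      using that E[of u w] E[of u v] E[of v w] by auto
    show "psi_less S (?M (s + u)) (?M (s + v)) \<longleftrightarrow> psi_less S (?M u) (?M v)"
      using E[of u v] E[of "s + u" "s + v"] by (simp add: add)
  qed
qed

text \<open>Two exponents of \<open>P\<close> that the order does not separate agree on all coordinates \<open>a < length S\<close>, hence are equal.\<close>

lemma valuation_least:
  assumes S: "set S \<subseteq> positive_roots n" and P: "P \<in> polys {..<length S}" "P \<noteq> 0"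
  shows "\<exists>u\<in>supp P. valuation S P = int_exponent u \<and>
    (\<forall>v\<in>supp P. v \<noteq> u \<longrightarrow> psi_less S (int_exponent u) (int_exponent v))"
proof -
  obtain E :: "nat \<Rightarrow> nat" where E: "\<And>u v. u \<in> supp P \<Longrightarrow> v \<in> supp P \<Longrightarrow> psi_less S (int_exponent u) (int_exponent v) \<longleftrightarrow>
      (\<Sum>a<length S. int (E a) * int_exponent u a) < (\<Sum>a<length S. int (E a) * int_exponent v a)"
    using psi_less_weights[OF S, of "int_exponent ` supp P"] by auto
  let ?e = "\<lambda>u. \<Sum>a<length S. int (E a) * int_exponent u a"
  have "supp P \<noteq> {}" using P(2) by simp
  then obtain u where u: "u \<in> supp P" "\<And>v. v \<in> supp P \<Longrightarrow> ?e u \<le> ?e v"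
  proof -
    have "Min (?e ` supp P) \<in> ?e ` supp P" using \<open>supp P \<noteq> {}\<close> by (intro Min_in) auto
    then obtain u where "u \<in> supp P" "?e u = Min (?e ` supp P)" by auto
    then show thesis using that[of u] by simp
  qed
  have eqI: "v = u" if "v \<in> supp P" "\<forall>a<length S. int_exponent u a = int_exponent v a" for v
  proof (rule poly_mapping_eqI)
    fix a
    show "cf v a = cf u a"
      using that(2) exps_lookup_zero[OF polysD[OF P(1) that(1)], of a] exps_lookup_zero[OF polysD[OF P(1) u(1)], of a]
      by (cases "a < length S") (auto simp: int_exponent_def)
  qed
  have least: "psi_less S (int_exponent u) (int_exponent v)" if v: "v \<in> supp P" "v \<noteq> u" for v
    using psi_less_total[of S "int_exponent u" "int_exponent v"] E[OF v(1) u(1)] u(2)[OF v(1)] eqI[OF v(1)] v(2) by auto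
  have "(THE u. u \<in> supp P \<and> (\<forall>v\<in>supp P. v \<noteq> u \<longrightarrow> psi_less S (int_exponent u) (int_exponent v))) = u"
  proof (rule the_equality)
    fix u' assume u': "u' \<in> supp P \<and> (\<forall>v\<in>supp P. v \<noteq> u' \<longrightarrow> psi_less S (int_exponent u') (int_exponent v))"
    show "u' = u"
    proof (rule ccontr)
      assume "u' \<noteq> u"
      then have "psi_less S (int_exponent u') (int_exponent u)" using u' u(1) by auto
      then have "?e u' < ?e u" using u' u(1) E[of u' u] by simp
      then show False using u(2)[of u'] u' by simp
    qed
  qed (use u least in auto)
  then show ?thesis using u(1) least by (auto simp: valuation_def)
qed

section \<open>Degeneration along a monomial curve\<close>

text \<open>On the curve \<open>y_a = t^{E_a}\<close> the term with exponent \<open>v\<close> contributes the power \<open>t^{E \<cdot> v}\<close>; factor out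
the lowest one, which is attained by \<open>m\<close> only.\<close>

lemma mpoly_eval_curve:
  fixes P :: "nat mpoly" and E :: "nat \<Rightarrow> nat"
  assumes P: "P \<in> polys {..<d}" and m: "m \<in> supp P"
    and least: "\<And>v. v \<in> supp P \<Longrightarrow> v \<noteq> m \<Longrightarrow> (\<Sum>a<d. E a * cf m a) < (\<Sum>a<d. E a * cf v a)"
  shows "\<exists>h. continuous_on UNIV h \<and> h 0 = cf P m \<and>
    (\<forall>t. mpoly_eval P (\<lambda>a. t ^ E a) = t ^ (\<Sum>a<d. E a * cf m a) * h t)"
proof -
  let ?e = "\<lambda>v. \<Sum>a<d. E a * cf v a"
  define h where "h = (\<lambda>t. \<Sum>v\<in>supp P. cf P v * t ^ (?e v - ?e m))"
  have "monval (\<lambda>a. t ^ E a) v = t ^ ?e v" if "v \<in> supp P" for t :: complex and v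
  proof -
    have "monval (\<lambda>a. t ^ E a) v = (\<Prod>a<d. (t ^ E a) ^ cf v a)"
      using polysD[OF P that] by (intro monval_on) (auto simp: exps_def)
    then show ?thesis by (simp add: power_mult[symmetric] power_sum[symmetric])
  qed
  moreover have "t ^ ?e v = t ^ ?e m * t ^ (?e v - ?e m)" if "v \<in> supp P" for t :: complex and v
    using least[OF that] by (cases "v = m") (auto simp: power_add[symmetric])
  ultimately have "mpoly_eval P (\<lambda>a. t ^ E a) = t ^ ?e m * h t" for t
    by (simp add: mpoly_eval_monval h_def sum_distrib_left algebra_simps)
  moreover have "h 0 = cf P m"
  proof -
    have "h 0 = (\<Sum>v\<in>supp P. if v = m then cf P v else 0)"
      unfolding h_def
    proof (intro sum.cong refl)
      fix v assume "v \<in> supp P"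
      then have "?e v - ?e m \<noteq> 0" if "v \<noteq> m" using least[of v] that by simp
      then show "cf P v * 0 ^ (?e v - ?e m) = (if v = m then cf P v else 0)"
        by (cases "v = m") (simp_all add: power_0_left)
    qed
    then show ?thesis using m by simp
  qed
  moreover have "continuous_on UNIV h" unfolding h_def by (intro continuous_intros)
  ultimately show ?thesis by blast
qed

text \<open>The term with exponent \<open>u\<close> contributes a multiple of \<open>t^{W(u)}\<close>, where \<open>W(u)\<close> is its
weight. Divide by \<open>t^\<mu>\<close>, where \<open>\<mu>\<close> is the minimal weight, and let \<open>t\<close> tend to \<open>0\<close>: precisely the
terms of the initial form survive.\<close>

lemma initial_form_vanishes:
  fixes h :: "'x \<Rightarrow> complex \<Rightarrow> complex" and w :: "'x \<Rightarrow> nat"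
  assumes V: "finite V" and f: "f \<in> polys V"
    and h: "\<And>x. x \<in> V \<Longrightarrow> continuous_on UNIV (h x)"
    and van: "\<forall>\<^sub>F t in at 0. mpoly_eval f (\<lambda>x. t ^ w x * h x t) = 0"
  shows "mpoly_eval (initial_form (\<lambda>u v. (\<Sum>x\<in>V. w x * cf u x) < (\<Sum>x\<in>V. w x * cf v x)) f) (\<lambda>x. h x 0) = 0"
proof (cases "f = 0")
  case True
  then show ?thesis by (simp add: initial_form_def mpoly_eval_zero)
next
  case False
  let ?W = "\<lambda>u. \<Sum>x\<in>V. w x * cf u x"
  define \<mu> where "\<mu> = Min (?W ` supp f)"
  have \<mu>: "\<mu> \<le> ?W u" if "u \<in> supp f" for u using that by (simp add: \<mu>_def)
  have "supp f \<noteq> {}" using False by simp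
  then obtain u0 where u0: "u0 \<in> supp f" "?W u0 = \<mu>"
    unfolding \<mu>_def using Min_in[of "?W ` supp f"] by fastforce
  define q where "q = (\<lambda>t. \<Sum>u\<in>supp f. cf f u * t ^ (?W u - \<mu>) * (\<Prod>x\<in>V. h x t ^ cf u x))"
  have mv: "monval a u = (\<Prod>x\<in>V. a x ^ cf u x)" if "u \<in> supp f" for u and a :: "'x \<Rightarrow> complex"
    using polysD[OF f that] V by (intro monval_on) (auto simp: exps_def)
  have pw: "t ^ ?W u = t ^ \<mu> * t ^ (?W u - \<mu>)" if "u \<in> supp f" for t :: complex and u
    using \<mu>[OF that] by (simp add: power_add[symmetric])
  have "mpoly_eval f (\<lambda>x. t ^ w x * h x t) = t ^ \<mu> * q t" for t
  proof -
    have "monval (\<lambda>x. t ^ w x * h x t) u = t ^ \<mu> * t ^ (?W u - \<mu>) * (\<Prod>x\<in>V. h x t ^ cf u x)" if "u \<in> supp f" for u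
      unfolding mv[OF that] pw[OF that, symmetric]
      by (simp add: power_mult_distrib prod.distrib power_mult[symmetric] power_sum[symmetric])
    then show ?thesis by (simp add: mpoly_eval_monval q_def sum_distrib_left algebra_simps)
  qed
  then have "\<forall>\<^sub>F t in at 0. t ^ \<mu> * q t = 0" using van by simp
  moreover have "\<forall>\<^sub>F t :: complex in at 0. t \<noteq> 0" by (simp add: eventually_at_filter)
  ultimately have "\<forall>\<^sub>F t in at 0. q t = 0" by eventually_elim simp
  then have "(q \<longlongrightarrow> 0) (at 0)" by (rule tendsto_eventually)
  moreover have "continuous_on UNIV q" unfolding q_def by (intro continuous_intros h)
  then have "(q \<longlongrightarrow> q 0) (at 0)" by (simp add: continuous_on_eq_continuous_at isContD)
  ultimately have q0: "q 0 = 0" using tendsto_unique[of "at (0::complex)"] by (metis trivial_limit_at)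
  let ?in = "initial_form (\<lambda>u v. ?W u < ?W v) f"
  have in_supp: "supp ?in = {u \<in> supp f. ?W u = \<mu>}"
    using \<mu> u0 by (auto simp: supp_initial_form not_less intro!: order_antisym)
  have "mpoly_eval ?in (\<lambda>x. h x 0) = (\<Sum>u\<in>{u \<in> supp f. ?W u = \<mu>}. cf f u * (\<Prod>x\<in>V. h x 0 ^ cf u x))"
    unfolding mpoly_eval_monval
  proof (intro sum.cong in_supp)
    fix u assume u: "u \<in> {u \<in> supp f. ?W u = \<mu>}"
    then have "u \<in> supp ?in" by (simp only: in_supp)
    then show "cf ?in u * monval (\<lambda>x. h x 0) u = cf f u * (\<Prod>x\<in>V. h x 0 ^ cf u x)"
      using u by (simp add: cf_initial_form mv)
  qed
  also have "\<dots> = (\<Sum>u\<in>supp f. if ?W u = \<mu> then cf f u * (\<Prod>x\<in>V. h x 0 ^ cf u x) else 0)"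
    by (simp add: sum.inter_filter)
  also have "\<dots> = q 0"
    unfolding q_def
  proof (intro sum.cong refl)
    fix u assume "u \<in> supp f"
    then have "?W u - \<mu> \<noteq> 0" if "?W u \<noteq> \<mu>" using \<mu>[of u] that by simp
    then show "(if ?W u = \<mu> then cf f u * (\<Prod>x\<in>V. h x 0 ^ cf u x) else 0) =
        cf f u * 0 ^ (?W u - \<mu>) * (\<Prod>x\<in>V. h x 0 ^ cf u x)"
      by (cases "?W u = \<mu>") (simp_all add: power_0_left)
  qed
  finally show ?thesis using q0 by simp
qed

lemma mpoly_eval_monom: "mpoly_eval (mterm u c) a = c * monval a u"
  using mpoly_eval_monom_times[of u c 1 a] by (simp add: mpoly_eval_one)

text \<open>No monomial vanishes at a point all of whose coordinates are nonzero.\<close>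

lemma init_ideal_no_monomial:
  assumes I: "I \<subseteq> polys V" and van: "\<And>f. f \<in> I \<Longrightarrow> mpoly_eval (initial_form lt f) c = 0"
    and c: "\<And>x. x \<in> V \<Longrightarrow> c x \<noteq> 0"
  shows "mterm u 1 \<notin> init_ideal V lt I"
proof
  assume "mterm u 1 \<in> init_ideal V lt I"
  moreover have "init_ideal V lt I \<subseteq> {f \<in> polys V. mpoly_eval f c = 0}"
    unfolding init_ideal_def using initial_forms_polys[OF I] van
    by (intro ideal_gen_least[OF poly_ideal_vanishing]) auto
  ultimately have u: "mterm u (1::complex) \<in> polys V" "mpoly_eval (mterm u 1) c = 0" by auto
  then have "supp u \<subseteq> V" by (simp add: polys_def exps_def)
  then have "monval c u \<noteq> 0" using c by (auto simp: monval_def)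
  then show False using u(2) by (simp add: mpoly_eval_monom)
qed

lemma initial_form_cong:
  assumes "\<And>u v. u \<in> supp f \<Longrightarrow> v \<in> supp f \<Longrightarrow> lt1 u v \<longleftrightarrow> lt2 u v"
  shows "initial_form lt1 f = initial_form lt2 f"
proof -
  have "supp (initial_form lt1 f) = supp (initial_form lt2 f)" using assms by (auto simp: supp_initial_form)
  then show ?thesis by (simp add: initial_form_eq_iff_supp)
qed

section \<open>The weight of a birational sequence\<close>

text \<open>The weight is \<open>w_J = E \<cdot> u_J\<close>, where \<open>u_J\<close> is the valuation of the \<open>J\<close>-th minor, that is, the \<open>J\<close>-th
column of the weighting matrix. The functional \<open>E\<close> agrees with \<open>\<prec>_\<Psi>\<close> on two finite sets: the
products of the matrix with the elements of \<open>B\<close>, and the exponents of all minors.\<close>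

lemma weight_for_matrix:
  assumes bir: "birational_seq k n S" and k: "k \<le> n" and fin: "finite B"
  shows "\<exists>w\<in>weight_space k n.
    (\<forall>u\<in>B. \<forall>v\<in>B. weight_less (plucker_index k n) w u v \<longleftrightarrow>
      psi_less S (matrix_times_exponent k n (weighting_matrix k n S) u)
        (matrix_times_exponent k n (weighting_matrix k n S) v)) \<and>
    (\<forall>u. mterm u 1 \<notin> init_ideal (plucker_index k n) (weight_less (plucker_index k n) w) (plucker_ideal k n))"
proof -
  let ?V = "plucker_index k n" and ?d = "length S" and ?I = "plucker_ideal k n"
  let ?M = "weighting_matrix k n S"
  let ?mte = "matrix_times_exponent k n ?M"
  have S: "set S \<subseteq> positive_roots n" using bir by (simp add: birational_seq_def)
  define P where "P = (\<lambda>J. minor k (psi n S (mvar :: nat \<Rightarrow> nat mpoly)) J)"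
  have P: "P J \<in> polys {..<?d}" if "J \<in> ?V" for J unfolding P_def by (rule polys_minor_psi[OF that k])
  have Pe: "mpoly_eval (P J) y = minor k (psi n S y) J" if "J \<in> ?V" for J y
    unfolding P_def by (rule minor_psi_eval[OF that k])
  have Pnz: "P J \<noteq> 0" if J: "J \<in> ?V" for J
    using minor_psi_nonzero[OF bir k J] Pe[OF J] by (auto simp: mpoly_eval_zero)
  have "\<forall>J\<in>?V. \<exists>m\<in>supp (P J). valuation S (P J) = int_exponent m \<and>
      (\<forall>v\<in>supp (P J). v \<noteq> m \<longrightarrow> psi_less S (int_exponent m) (int_exponent v))"
    using valuation_least[OF S P Pnz] by blast
  from bchoice[OF this[unfolded Bex_def]] obtain m where m0:
    "\<forall>J\<in>?V. m J \<in> supp (P J) \<and> valuation S (P J) = int_exponent (m J) \<and>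
      (\<forall>v\<in>supp (P J). v \<noteq> m J \<longrightarrow> psi_less S (int_exponent (m J)) (int_exponent v))" by (elim exE)
  have m: "m J \<in> supp (P J)" "valuation S (P J) = int_exponent (m J)"
      "\<And>v. v \<in> supp (P J) \<Longrightarrow> v \<noteq> m J \<Longrightarrow> psi_less S (int_exponent (m J)) (int_exponent v)"
    if "J \<in> ?V" for J using m0 that by auto
  define D where "D = ?mte ` B \<union> (\<Union>J\<in>?V. int_exponent ` supp (P J))"
  have "finite D" using fin finite_plucker_index by (simp add: D_def)
  from psi_less_weights[OF S this] obtain E :: "nat \<Rightarrow> nat" where
    "\<forall>x\<in>D. \<forall>y\<in>D. psi_less S x y \<longleftrightarrow> (\<Sum>a<?d. int (E a) * x a) < (\<Sum>a<?d. int (E a) * y a)" by (elim exE)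
  note E = this[rule_format]
  define w0 where "w0 = (\<lambda>J. \<Sum>a<?d. E a * cf (m J) a)"
  define w where "w = (\<Sum>J\<in>?V. mterm J (real (w0 J)))"
  have cw: "cf w J = (if J \<in> ?V then real (w0 J) else 0)" for J
    by (simp add: w_def lookup_sum lookup_single when_def finite_plucker_index)
  then have wV: "w \<in> weight_space k n" by (auto simp: weight_space_def in_keys_iff split: if_splits)
  have wtw: "weight ?V w u = real (\<Sum>J\<in>?V. w0 J * cf u J)" for u
    by (simp add: weight_def cw)
  have M: "?M a J = int (cf (m J) a)" if "J \<in> ?V" for a J
    using m(2)[OF that] by (simp add: weighting_matrix_def P_def int_exponent_def)
  have wM: "int (\<Sum>J\<in>?V. w0 J * cf u J) = (\<Sum>a<?d. int (E a) * ?mte u a)" for u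
  proof -
    have "(\<Sum>a<?d. int (E a) * ?mte u a) = (\<Sum>a<?d. \<Sum>J\<in>?V. int (E a) * (int (cf (m J) a) * int (cf u J)))"
      by (simp add: matrix_times_exponent_def M sum_distrib_left)
    also have "\<dots> = (\<Sum>J\<in>?V. \<Sum>a<?d. int (E a) * (int (cf (m J) a) * int (cf u J)))" by (rule sum.swap)
    also have "\<dots> = int (\<Sum>J\<in>?V. w0 J * cf u J)"
      by (simp add: w0_def sum_distrib_right mult.assoc)
    finally show ?thesis ..
  qed
  have weight_less_nat: "weight_less ?V w = (\<lambda>u v. (\<Sum>J\<in>?V. w0 J * cf u J) < (\<Sum>J\<in>?V. w0 J * cf v J))"
    by (intro ext) (simp only: weight_less_def wtw of_nat_less_iff)
  have "weight_less ?V w u v \<longleftrightarrow> psi_less S (?mte u) (?mte v)" if "u \<in> B" "v \<in> B" for u v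
  proof -
    have "weight_less ?V w u v \<longleftrightarrow> int (\<Sum>J\<in>?V. w0 J * cf u J) < int (\<Sum>J\<in>?V. w0 J * cf v J)"
      by (simp only: weight_less_nat of_nat_less_iff)
    also have "\<dots> \<longleftrightarrow> psi_less S (?mte u) (?mte v)"
      unfolding wM using that by (intro E[symmetric]) (auto simp: D_def)
    finally show ?thesis .
  qed
  moreover have "mterm u 1 \<notin> init_ideal ?V (weight_less ?V w) ?I" for u
  proof -
    have "\<exists>h. continuous_on UNIV h \<and> h 0 = cf (P J) (m J) \<and>
        (\<forall>t. mpoly_eval (P J) (\<lambda>a. t ^ E a) = t ^ w0 J * h t)" if J: "J \<in> ?V" for J
      unfolding w0_def
    proof (rule mpoly_eval_curve[OF P[OF J] m(1)[OF J]])
      fix v assume v: "v \<in> supp (P J)" "v \<noteq> m J"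
      have "int_exponent (m J) \<in> D" "int_exponent v \<in> D" using J v(1) m(1)[OF J] by (auto simp: D_def)
      then have "(\<Sum>a<?d. int (E a) * int_exponent (m J) a) < (\<Sum>a<?d. int (E a) * int_exponent v a)"
        using E m(3)[OF J v] by blast
      then have "int (\<Sum>a<?d. E a * cf (m J) a) < int (\<Sum>a<?d. E a * cf v a)"
        by (simp add: int_exponent_def)
      then show "(\<Sum>a<?d. E a * cf (m J) a) < (\<Sum>a<?d. E a * cf v a)" by (simp only: of_nat_less_iff)
    qed
    then have "\<forall>J\<in>?V. \<exists>h. continuous_on UNIV h \<and> h 0 = cf (P J) (m J) \<and>
        (\<forall>t. mpoly_eval (P J) (\<lambda>a. t ^ E a) = t ^ w0 J * h t)" by blast
    from bchoice[OF this] obtain h where h0: "\<forall>J\<in>?V. continuous_on UNIV (h J) \<and> h J 0 = cf (P J) (m J) \<and>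
        (\<forall>t. mpoly_eval (P J) (\<lambda>a. t ^ E a) = t ^ w0 J * h J t)" by (elim exE)
    have h: "continuous_on UNIV (h J)" "h J 0 = cf (P J) (m J)"
        "mpoly_eval (P J) (\<lambda>a. t ^ E a) = t ^ w0 J * h J t" if "J \<in> ?V" for J t
      using h0 that by auto
    have hnz: "h J 0 \<noteq> 0" if "J \<in> ?V" for J using h(2)[OF that] m(1)[OF that] by (simp add: in_keys_iff)
    have IV: "?I \<subseteq> polys ?V" using plucker_ideal_poly_ideal[of k n] by (simp add: poly_ideal_def)
    \<comment> \<open>some minor must not vanish near \<open>t = 0\<close>, so that the curve stays in the Grassmannian\<close>
    have "{..<k} \<in> ?V" using k by (auto simp: plucker_index_def)
    then obtain J0 where J0: "J0 \<in> ?V" by blast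
    have "mpoly_eval (initial_form (weight_less ?V w) f) (\<lambda>J. h J 0) = 0" if f: "f \<in> ?I" for f
      unfolding weight_less_nat
    proof (rule initial_form_vanishes[OF finite_plucker_index _ h(1)])
      show fV: "f \<in> polys ?V" using f IV by blast
      have "(h J0 \<longlongrightarrow> h J0 0) (at 0)" using h(1)[OF J0] by (simp add: continuous_on_eq_continuous_at isContD)
      then have "\<forall>\<^sub>F t in at 0. h J0 t \<noteq> 0" using hnz[OF J0] by (rule tendsto_imp_eventually_ne)
      moreover have "\<forall>\<^sub>F t :: complex in at 0. t \<noteq> 0" by (simp add: eventually_at_filter)
      ultimately show "\<forall>\<^sub>F t in at 0. mpoly_eval f (\<lambda>J. t ^ w0 J * h J t) = 0"
      proof eventually_elim
        fix t :: complex assume t: "h J0 t \<noteq> 0" "t \<noteq> 0"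
        have eq: "minor k (psi n S (\<lambda>a. t ^ E a)) J = t ^ w0 J * h J t" if "J \<in> ?V" for J
          using Pe[OF that] h(3)[OF that] by simp
        then have "minor k (psi n S (\<lambda>a. t ^ E a)) J0 \<noteq> 0" using J0 t by simp
        then have "mpoly_eval f (minor k (psi n S (\<lambda>a. t ^ E a))) = 0"
          by (rule plucker_ideal_vanishes[OF k f J0])
        moreover have "mpoly_eval f (\<lambda>J. t ^ w0 J * h J t) = mpoly_eval f (minor k (psi n S (\<lambda>a. t ^ E a)))"
          using fV eq by (intro mpoly_eval_cong[of f ?V]) auto
        ultimately show "mpoly_eval f (\<lambda>J. t ^ w0 J * h J t) = 0" by simp
      qed
    qed
    then show ?thesis by (rule init_ideal_no_monomial[OF IV _ hnz])
  qed
  ultimately show ?thesis using wV by blast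
qed

theorem theorem1:
  fixes k n :: nat and S :: root_seq
  assumes "1 \<le> k" and "k < n" and "iterated_seq k n S"
  shows "\<exists>C\<in>trop_fan k n. rel_interior C \<noteq> {} \<and>
    (\<forall>w\<in>rel_interior C.
      initial_ideal_matrix k n S (weighting_matrix k n S) (plucker_ideal k n) =
      initial_ideal k n w (plucker_ideal k n))"
proof -
  let ?V = "plucker_index k n" and ?I = "plucker_ideal k n"
  let ?M = "weighting_matrix k n S"
  let ?mte = "matrix_times_exponent k n ?M"
  let ?lt = "\<lambda>u v. psi_less S (?mte u) (?mte v)"
  have k: "k \<le> n" and bir: "birational_seq k n S" using assms by (simp_all add: iterated_seq_def)
  have S: "set S \<subseteq> positive_roots n" using bir by (simp add: birational_seq_def)
  note V = finite_plucker_index[of k n] and I = plucker_ideal_poly_ideal[of k n] plucker_ideal_graded[of k n]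
  have W: "weight_order ?lt" by (rule weight_order_matrix[OF S])
  obtain tb where tb: "monomial_order ?V tb" using ex_monomial_order[OF V] by blast
  interpret o: monomial_order ?V "refine tb ?lt" by (rule monomial_order_refine[OF tb W])
  from o.finite_reduced_basis[OF I] obtain G where G: "G \<subseteq> ?I" "finite G"
      "\<forall>g\<in>G. homogeneous g \<and> (\<exists>m. supp g \<inter> leads (refine tb ?lt) ?I = {m})"
      "\<forall>m\<in>leads (refine tb ?lt) ?I. \<exists>g\<in>G. \<exists>b. \<exists>s\<in>exps ?V. is_lead (refine tb ?lt) g b \<and> m = s + b"
    by (elim exE conjE)
  have "finite (\<Union>g\<in>G. supp g)" using G(2) by simp
  from weight_for_matrix[OF bir k this] obtain w0 where w0: "w0 \<in> weight_space k n"
    and agree: "\<forall>u\<in>(\<Union>g\<in>G. supp g). \<forall>v\<in>(\<Union>g\<in>G. supp g). weight_less ?V w0 u v \<longleftrightarrow> ?lt u v"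
    and nomon: "\<forall>u. mterm u 1 \<notin> init_ideal ?V (weight_less ?V w0) ?I"
    by (elim bexE conjE)
  have M_w0: "init_ideal ?V ?lt ?I = init_ideal ?V (weight_less ?V w0) ?I"
  proof (rule init_ideal_eqI[OF tb W weight_order_weight_less I G(1)])
    show "initial_form ?lt g = initial_form (weight_less ?V w0) g" if "g \<in> G" for g
      using agree that by (intro initial_form_cong) blast
  qed (use G in blast)+
  \<comment> \<open>the relative interior of the cone\<close>
  define K where "K = {w \<in> weight_space k n. initial_ideal k n w ?I = initial_ideal k n w0 ?I}"
  have K: "K = {w. supp w \<subseteq> ?V \<and> init_ideal ?V (weight_less ?V w) ?I = init_ideal ?V (weight_less ?V w0) ?I}"
    by (auto simp: K_def weight_space_def initial_ideal_eq_init_ideal)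
  have ri: "rel_interior (closure K) = K"
    unfolding K using w0 by (intro same_init_ideal_rel_interior[OF V I]) (simp add: weight_space_def)
  have "closed (weight_space k n)"
  proof -
    have "weight_space k n = (\<Inter>J\<in>- ?V. {w. cf w J = 0})" by (auto simp: weight_space_def in_keys_iff)
    moreover have "closed {w :: nat set \<Rightarrow>\<^sub>0 real. cf w J = 0}" for J
      using linear_continuous_on[OF bounded_linear_lookup] by (intro closed_Collect_eq continuous_on_const)
    ultimately show ?thesis by (simp add: closed_INT)
  qed
  then have "closure K \<subseteq> weight_space k n" by (intro closure_minimal) (auto simp: K_def)
  moreover have "mterm u 1 \<notin> init_ideal ?V (weight_less ?V w) ?I" if "w \<in> closure K" for u w
    using nomon by (intro no_monomial_closure[OF I(1) that]) (auto simp: K)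
  ultimately have "closure K \<subseteq> trop_grassmannian k n"
    by (auto simp: trop_grassmannian_def initial_ideal_eq_init_ideal)
  moreover have "closure K \<in> groebner_fan k n" using w0 unfolding groebner_fan_def K_def by blast
  ultimately have "closure K \<in> trop_fan k n" by (simp add: trop_fan_def)
  moreover have "w0 \<in> K" using w0 by (simp add: K_def)
  moreover have "initial_ideal_matrix k n S ?M ?I = initial_ideal k n w ?I" if "w \<in> K" for w
    using that M_w0 by (simp add: K_def initial_ideal_matrix_def initial_ideal_eq_init_ideal init_ideal_def genideal_plucker_ring)
  ultimately show ?thesis using ri by (intro bexI[of _ "closure K"]) auto
qed

end
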